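(* Let $m\in\mathbb N$, $J=\{1,\dots,m\}$. Let $q_0,q_1\in(0,\infty]$ and $\vec p_i=(p_{ij})_{j\in J},\vec s_i=(s_{ij})_{j\in J},\vec r_i=(r_{ij})_{j\in J}\in(0,\infty]^m$ for $i=0,1$ satisfy, for all $j\in J$, $$\frac1{p_{1j}}-\frac1{p_{0j}}=\frac1{s_{1j}}-\frac1{s_{0j}}=\frac1{r_{0j}}-\frac1{r_{1j}}=:\frac1{\gamma_j},\qquad \frac1{q_1}-\frac1{q_0}=\frac1\gamma:=\sum_{j\in J}\frac1{\gamma_j}.$$ Let $w_{1j},v_{1j}$ ($j\in J$) be weights with $[w_{1j},v_{1j}]_{(s_{1j},r_{1j})}<\infty$, put $w_1:=\prod_jw_{1j}$, and for each $j$ let $(t_{0j},t_{1j},w_{t_{1j}},v_{t_{1j}},W_j)$ be associated to $(\frac1{\gamma_j},s_{0j},r_{0j},w_{1j},v_{1j})$ as in the context. Assume: (i) $\mathcal M$ is bounded from $L^{t_{1j}}_{v_{t_{1j}}}(\Omega)$ to $L^{t_{1j}}_{w_{t_{1j}}}(\Omega)$ for all $j\in J$; (ii) for each $j$ there are a set $V_j$ and a map $S_j:V_j\to L^0(\Omega)$, there is a map $$T:\prod_{j\in J}\ \bigcup_{(w_{0j},v_{0j})\in W_j}S_j^{-1}\big(L^{p_{0j}}_{v_{0j}}(\Omega)\big)\to L^0(\Omega),$$ and a function $\phi:\mathbb R^m\to\mathbb R$ increasing in each component, such that for all $((w_{0j},v_{0j}))_{j\in J}\in W_1\times\dots\times W_m$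 and all $\vec f=(f_j)_j\in\prod_jS_j^{-1}(L^{p_{0j}}_{v_{0j}}(\Omega))$, $$\|T\vec f\|_{L^{q_0}_{w_0}(\Omega)}\le\phi\big(([w_{0j},v_{0j}]_{(s_{0j},r_{0j})})_{j\in J}\big)\prod_{j\in J}\|S_jf_j\|_{L^{p_{0j}}_{v_{0j}}(\Omega)},\qquad w_0:=\prod_jw_{0j}.$$ Then $\prod_jS_j^{-1}(L^{p_{1j}}_{v_{1j}}(\Omega))$ is contained in the domain of $T$, and for every $\kappa\in(1,\infty)$ and every $\vec f\in\prod_jS_j^{-1}(L^{p_{1j}}_{v_{1j}}(\Omega))$, $$\|T\vec f\|_{L^{q_1}_{w_1}(\Omega)}\le\kappa^\beta\,\phi(\vec C_\kappa)\prod_{j\in J}\|S_jf_j\|_{L^{p_{1j}}_{v_{1j}}(\Omega)},$$ where $\beta:=\sum_j t_{1j}/|\gamma_j|$ and $C_{\kappa j}:=\big(\kappa'\|\mathcal M\|_{L^{t_{1j}}_{v_{t_{1j}}}\to L^{t_{1j}}_{w_{t_{1j}}}}\big)^{t_{1j}/|\gamma_j|}[w_{1j},v_{1j}]_{(s_{1j},r_{1j})}^{t_{1j}/t_{0j}}$.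
   Context: $(\Omega,\mu)$ is a $\sigma$-finite measure space with a fixed basis of sets $\mathcal U$: a countable collection of measurable sets $U$ with $0<\mu(U)<\infty$ such that $\bigcup_{U\in\mathcal U}U=\Omega$ and for all $x,y\in\Omega$ there is $U\in\mathcal U$ with $x,y\in U$. A weight is a measurable function $w:\Omega\to(0,\infty)$. $L^0(\Omega)$ denotes the measurable functions. For $p\in(0,\infty]$ and a weight $w$, $L^p_w(\Omega)$ is the space of measurable $f$ with $\|f\|_{L^p_w(\Omega)}:=\|fw\|_{L^p(\Omega)}<\infty$. For $s,r\in(0,\infty]$ and weights $w,v$, $[w,v]_{(s,r)}:=\sup_{U\in\mathcal U}\mu(U)^{-\frac1s-\frac1r}\|w\|_{L^s(U)}\|v^{-1}\|_{L^r(U)}$ (with $\frac1\infty:=0$). The maximal operator is $\mathcal Mf:=\sup_{U\in\mathcal U}\mu(U)^{-1}\|f\|_{L^1(U)}\mathbf 1_U$; $\|\mathcal M\|_{X\to Y}:=\sup\{\|\mathcal Mf\|_Y:\|f\|_X\le1\}$. For $\kappa\in(1,\infty)$, $\kappa'=\kappa/(\kappa-1)$. Weight classes and rescaled exponents: given $\frac1\gamma\in\mathbb R$, $s_0,r_0\in(0,\infty]$ and weights $w,v$, define $s,r\in(0,\infty]$ by $\frac1s-\frac1{s_0}=\frac1{r_0}-\frac1r=\frac1\gamma$ and $\alpha$ by $\frac1\alpha=\frac1{s_0}+\frac1{r_0}$. If $\frac1\gamma>0$: $t_0:=s_0/\alpha$, $t:=s/\alpha$, $(w_t,v_t):=(w^\alpha,v^\alpha)$.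 If $\frac1\gamma=0$: $t_0:=t:=1$ (no $w_t,v_t$). If $\frac1\gamma<0$: $t_0:=r_0/\alpha$, $t:=r/\alpha$, $(w_t,v_t):=(v^{-\alpha},w^{-\alpha})$. Set $W:=\{(w,v)\}$ if $\frac1\gamma=0$, and otherwise $W:=\{(\tilde w,\tilde v)$ pairs of weights $:\tilde w\tilde v^{-1}=wv^{-1},\ [\tilde w,\tilde v]_{(s_0,r_0)}<\infty\}$. Convention: when $\frac1\gamma=0$, the hypothesis "$\mathcal M$ bounded from $L^t_{v_t}$ to $L^t_{w_t}$" is regarded as satisfied and any factor of the form $(\cdots\|\mathcal M\|_{L^t_{v_t}\to L^t_{w_t}})^{t/|\gamma|}$ or $\kappa^{t/|\gamma|}$ is interpreted as $1$ (exponent $0$). *)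

theory Defs
  imports "HOL-Analysis.Analysis"
begin

(* Exponents p in (0,\<infinity>] are represented as nonzero ennreal values; 1/\<infinity> = 0. *)
definition rinv :: "ennreal \<Rightarrow> real" where
  "rinv p = enn2real (inverse p)"

(* power of an extended nonnegative number with a positive real exponent *)
definition epow :: "ennreal \<Rightarrow> real \<Rightarrow> ennreal" where
  "epow x a = (if x = \<infinity> then \<infinity> else ennreal (enn2real x powr a))"

definition enorm :: "'a measure \<Rightarrow> ennreal \<Rightarrow> ('a \<Rightarrow> ennreal) \<Rightarrow> ennreal" where
  "enorm M p g =
     (if p = \<infinity> then Inf {c. AE x in M. g x \<le> c}
      else epow (\<integral>\<^sup>+ x. epow (g x) (enn2real p) \<partial>M) (1 / enn2real p))"

definition Lpn :: "'a measure \<Rightarrow> ennreal \<Rightarrow> ('a \<Rightarrow> real) \<Rightarrow> ennreal" where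
  "Lpn M p f = enorm M p (\<lambda>x. ennreal \<bar>f x\<bar>)"

definition Lpw :: "'a measure \<Rightarrow> ennreal \<Rightarrow> ('a \<Rightarrow> real) \<Rightarrow> ('a \<Rightarrow> real) \<Rightarrow> ennreal" where
  "Lpw M p w f = Lpn M p (\<lambda>x. f x * w x)"

definition Lpw_space :: "'a measure \<Rightarrow> ennreal \<Rightarrow> ('a \<Rightarrow> real) \<Rightarrow> ('a \<Rightarrow> real) set" where
  "Lpw_space M p w = {f \<in> borel_measurable M. Lpw M p w f < \<infinity>}"

definition weight :: "'a measure \<Rightarrow> ('a \<Rightarrow> real) \<Rightarrow> bool" where
  "weight M w \<longleftrightarrow> w \<in> borel_measurable M \<and> (\<forall>x\<in>space M. 0 < w x)"

definition basis_of_sets :: "'a measure \<Rightarrow> 'a set set \<Rightarrow> bool" where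
  "basis_of_sets M \<U> \<longleftrightarrow> countable \<U>
     \<and> (\<forall>U\<in>\<U>. U \<in> sets M \<and> 0 < emeasure M U \<and> emeasure M U < \<infinity>)
     \<and> \<Union>\<U> = space M
     \<and> (\<forall>x\<in>space M. \<forall>y\<in>space M. \<exists>U\<in>\<U>. x \<in> U \<and> y \<in> U)"

definition charw :: "'a measure \<Rightarrow> 'a set set \<Rightarrow> ennreal \<Rightarrow> ennreal
     \<Rightarrow> ('a \<Rightarrow> real) \<Rightarrow> ('a \<Rightarrow> real) \<Rightarrow> ennreal" where
  "charw M \<U> s r w v = (SUP U\<in>\<U>. ennreal (measure M U powr (- rinv s - rinv r))
      * Lpn M s (\<lambda>x. indicator U x * w x) * Lpn M r (\<lambda>x. indicator U x / v x))"

definition maxop :: "'a measure \<Rightarrow> 'a set set \<Rightarrow> ('a \<Rightarrow> real) \<Rightarrow> 'a \<Rightarrow> ennreal" where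
  "maxop M \<U> f x = (SUP U\<in>\<U>. ennreal (1 / measure M U)
      * (\<integral>\<^sup>+ y\<in>U. ennreal \<bar>f y\<bar> \<partial>M) * indicator U x)"

definition maxop_norm :: "'a measure \<Rightarrow> 'a set set \<Rightarrow> ennreal
     \<Rightarrow> ('a \<Rightarrow> real) \<Rightarrow> ('a \<Rightarrow> real) \<Rightarrow> ennreal" where
  "maxop_norm M \<U> t v w = (SUP f\<in>{f \<in> borel_measurable M. Lpw M t v f \<le> 1}.
      enorm M t (\<lambda>x. maxop M \<U> f x * ennreal (w x)))"

(* rescaled exponents; g stands for 1/\<gamma>, a for 1/\<alpha> = 1/s0 + 1/r0 *)
definition ainv :: "ennreal \<Rightarrow> ennreal \<Rightarrow> real" where
  "ainv s0 r0 = rinv s0 + rinv r0"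

definition t0par :: "real \<Rightarrow> ennreal \<Rightarrow> ennreal \<Rightarrow> ennreal" where
  "t0par g s0 r0 =
     (if g > 0 then inverse (ennreal (rinv s0 / ainv s0 r0))
      else if g < 0 then inverse (ennreal (rinv r0 / ainv s0 r0))
      else 1)"

(* here s, r are the exponents with 1/s - 1/s0 = 1/r0 - 1/r = g *)
definition tpar :: "real \<Rightarrow> ennreal \<Rightarrow> ennreal \<Rightarrow> ennreal \<Rightarrow> ennreal \<Rightarrow> ennreal" where
  "tpar g s0 r0 s r =
     (if g > 0 then inverse (ennreal (rinv s / ainv s0 r0))
      else if g < 0 then inverse (ennreal (rinv r / ainv s0 r0))
      else 1)"

(* (w_t, v_t); irrelevant (chosen as (w,v)) when g = 0 *)
definition wtpar :: "real \<Rightarrow> ennreal \<Rightarrow> ennreal \<Rightarrow> ('a \<Rightarrow> real) \<Rightarrow> ('a \<Rightarrow> real) \<Rightarrow> 'a \<Rightarrow> real" where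
  "wtpar g s0 r0 w v =
     (if g > 0 then (\<lambda>x. w x powr (1 / ainv s0 r0))
      else if g < 0 then (\<lambda>x. v x powr (- 1 / ainv s0 r0))
      else w)"

definition vtpar :: "real \<Rightarrow> ennreal \<Rightarrow> ennreal \<Rightarrow> ('a \<Rightarrow> real) \<Rightarrow> ('a \<Rightarrow> real) \<Rightarrow> 'a \<Rightarrow> real" where
  "vtpar g s0 r0 w v =
     (if g > 0 then (\<lambda>x. v x powr (1 / ainv s0 r0))
      else if g < 0 then (\<lambda>x. w x powr (- 1 / ainv s0 r0))
      else v)"

definition Wset :: "'a measure \<Rightarrow> 'a set set \<Rightarrow> real \<Rightarrow> ennreal \<Rightarrow> ennreal
     \<Rightarrow> ('a \<Rightarrow> real) \<Rightarrow> ('a \<Rightarrow> real) \<Rightarrow> (('a \<Rightarrow> real) \<times> ('a \<Rightarrow> real)) set" where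
  "Wset M \<U> g s0 r0 w v =
     (if g = 0 then {(w, v)}
      else {(w', v'). weight M w' \<and> weight M v'
              \<and> (\<forall>x\<in>space M. w' x / v' x = w x / v x)
              \<and> charw M \<U> s0 r0 w' v' < \<infinity>})"

end

theory Submission
  imports Defs
begin

text \<open>
  Write \<open>g = 1/\<gamma>\<close>. Every pair in \<open>W\<close> that is needed has the form
  \<open>(w G\<^sup>-\<^sup>g, v G\<^sup>-\<^sup>g)\<close> for a positive integrable \<open>G\<close>. Given \<open>F \<ge> 0\<close> with
  \<open>\<integral>F \<le> 1\<close>, the Rubio de Francia iteration of \<open>f \<mapsto> (w\<^sub>t / v\<^sub>t) \<M> f\<close>, which is bounded on
  \<open>L\<^sup>t(v\<^sub>t)\<close>, started at \<open>F\<^bsup>1/t\<^esup> / v\<^sub>t\<close>, yields \<open>\<psi>\<close> with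
  \<open>\<M>\<psi> \<le> \<kappa>' \<parallel>\<M>\<parallel> \<psi> v\<^sub>t / w\<^sub>t\<close>; then \<open>G = (\<psi> v\<^sub>t)\<^sup>t\<close> satisfies \<open>F \<le> G\<close> and
  \<open>\<integral>G \<le> \<kappa>\<^sup>t\<close>, and Hoelder's inequality bounds the characteristic of the new pair. The case
  \<open>g < 0\<close> follows by exchanging \<open>(w, v)\<close> with \<open>(1/v, 1/w)\<close> and \<open>s\<close> with \<open>r\<close>.

  For the components with \<open>g > 0\<close> take \<open>F\<close> to be the normalised \<open>p\<^sub>1\<close>-th power of
  \<open>S f v\<^sub>1\<close>. All components with \<open>g < 0\<close> share one arbitrary \<open>F\<close>, which plays the role of the
  dual function: the norm of \<open>T f\<close> in \<open>L\<^bsup>q\<^sub>1\<^esup>\<close> is a supremum over such \<open>F\<close>.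
\<close>

section \<open>Lebesgue norms\<close>

text \<open>Multiplication by \<open>G powr g\<close> with \<open>G\<close> integrable moves an
  index by exactly \<open>g\<close> in Hoelder's inequality, which is why the shifts of the p, s and
  r indices agree. Giving both weights the same factor keeps their quotient fixed, as membership in
  W demands. The sign of \<open>g\<close> decides which side is easy. For \<open>g > 0\<close> the
  function S f has to pass to a higher exponent, which works only if \<open>G\<close> dominates a
  power of S f itself, while T f returns by Hoelder. For \<open>g < 0\<close> the function S f is
  handled by Hoelder, and \<open>G\<close> would have to be tied to T f, whose size is unknown and
  whose weight may depend on \<open>G\<close>; testing against all F breaks this circle. In either
  case a component pays \<kappa> powr (t * |g|) exactly once, and the product of these costs is
  \<kappa> to the power \<beta>. For the characteristic, the pointwise lower bound of \<psi> by its
  average over U controls the factor with w, and Hoelder with the integral of \<psi> over U controls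
  the factor with 1/v. That integral cancels in the product, leaving only the old characteristic and
  the constant of the lower bound.\<close>

text \<open>The index \<open>c\<close> is the reciprocal of the exponent, so that \<open>c = 0\<close> is the supremum norm and
  Hoelder's inequality adds indices.\<close>

definition nrm :: "'a measure \<Rightarrow> real \<Rightarrow> ('a \<Rightarrow> real) \<Rightarrow> ennreal" where
  "nrm M c f = (if c = 0 then Inf {C. AE x in M. ennreal \<bar>f x\<bar> \<le> C}
      else epow (\<integral>\<^sup>+ x. ennreal (\<bar>f x\<bar> powr (1 / c)) \<partial>M) c)"

section \<open>Elementary properties of the norm\<close>

lemma epow_ennreal [simp]: "0 \<le> x \<Longrightarrow> epow (ennreal x) a = ennreal (x powr a)"
  by (simp add: epow_def)

lemma epow_le_iff:
  assumes "0 < c" "0 \<le> B"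
  shows "epow y c \<le> ennreal B \<longleftrightarrow> y \<le> ennreal (B powr (1 / c))"
proof (cases y)
  case (real r)
  have "r powr c \<le> B \<longleftrightarrow> r \<le> B powr (1 / c)"
  proof
    assume "r powr c \<le> B"
    then have "(r powr c) powr (1 / c) \<le> B powr (1 / c)"
      using assms by (intro powr_mono2) auto
    then show "r \<le> B powr (1 / c)"
      using assms real by (simp add: powr_powr)
  next
    assume "r \<le> B powr (1 / c)"
    then have "r powr c \<le> (B powr (1 / c)) powr c"
      using assms real by (intro powr_mono2) auto
    then show "r powr c \<le> B"
      using assms real by (simp add: powr_powr)
  qed
  then show ?thesis
    using real assms by simp
qed (simp add: epow_def top_unique)

lemma rinv_nonneg [simp]: "0 \<le> rinv p"
  by (simp add: rinv_def)

lemma Lpn_eq_nrm: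
  assumes "p \<noteq> 0"
  shows "Lpn M p f = nrm M (rinv p) f"
proof (cases p)
  case (real r)
  then have "0 < r"
    using assms by (cases "r = 0") auto
  moreover have "rinv p = 1 / r"
    using real \<open>0 < r\<close> by (simp add: rinv_def inverse_ennreal divide_inverse)
  ultimately show ?thesis
    using real by (simp add: Lpn_def enorm_def nrm_def)
next
  case top
  then show ?thesis
    by (simp add: Lpn_def enorm_def nrm_def rinv_def)
qed

text \<open>The infimum of the essential bounds is itself an essential bound: it is the infimum of a
  sequence of them, and countably many null sets may be united.\<close>

lemma nrm_0_le_iff: "nrm M 0 f \<le> B \<longleftrightarrow> (AE x in M. ennreal \<bar>f x\<bar> \<le> B)"
proof
  assume le: "nrm M 0 f \<le> B"
  let ?S = "{C. AE x in M. ennreal \<bar>f x\<bar> \<le> C}"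
  have ne: "top \<in> ?S" by simp
  then obtain u where u: "range u \<subseteq> ?S" "Inf ?S = (INF i. u (i::nat))"
    using ennreal_Inf_countable_INF[of ?S] by blast
  then have "\<And>i. AE x in M. ennreal \<bar>f x\<bar> \<le> u i"
    by blast
  then have "AE x in M. \<forall>i. ennreal \<bar>f x\<bar> \<le> u i"
    by (simp add: AE_all_countable)
  then show "AE x in M. ennreal \<bar>f x\<bar> \<le> B"
  proof eventually_elim
    case (elim x)
    then have "ennreal \<bar>f x\<bar> \<le> (INF i. u i)"
      by (intro INF_greatest) auto
    then show ?case
      using le u(2) by (simp add: nrm_def)
  qed
next
  assume "AE x in M. ennreal \<bar>f x\<bar> \<le> B"
  then show "nrm M 0 f \<le> B"
    unfolding nrm_def by (simp add: Inf_lower)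
qed

text \<open>Norm estimates are stated with a finite right-hand side \<open>ennreal B\<close>, so
  that the outer power can be moved across and the work is done on integrals.\<close>

lemma nrm_pos_le_iff:
  assumes "0 < c" "0 \<le> B"
  shows "nrm M c f \<le> ennreal B
    \<longleftrightarrow> (\<integral>\<^sup>+ x. ennreal (\<bar>f x\<bar> powr (1 / c)) \<partial>M) \<le> ennreal (B powr (1 / c))"
  using assms by (simp add: nrm_def epow_le_iff)

lemma nrm_mono_AE:
  assumes "0 \<le> c" "AE x in M. \<bar>f x\<bar> \<le> \<bar>h x\<bar>"
  shows "nrm M c f \<le> nrm M c h"
proof (cases "c = 0")
  case True
  have "AE x in M. ennreal \<bar>h x\<bar> \<le> nrm M 0 h"
    using nrm_0_le_iff by blast
  with assms(2) have "AE x in M. ennreal \<bar>f x\<bar> \<le> nrm M 0 h"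
  proof eventually_elim
    case (elim x)
    then show ?case
      using order_trans[of "ennreal \<bar>f x\<bar>" "ennreal \<bar>h x\<bar>"] by (simp add: ennreal_leI)
  qed
  then show ?thesis
    using True by (simp add: nrm_0_le_iff)
next
  case False
  then have c: "0 < c" using assms by simp
  have le: "(\<integral>\<^sup>+ x. ennreal (\<bar>f x\<bar> powr (1 / c)) \<partial>M) \<le> (\<integral>\<^sup>+ x. ennreal (\<bar>h x\<bar> powr (1 / c)) \<partial>M)"
    using assms(2) by (intro nn_integral_mono_AE, eventually_elim)
      (use c in \<open>auto intro!: ennreal_leI powr_mono2\<close>)
  show ?thesis
  proof (cases "nrm M c h")
    case (real B)
    then have "(\<integral>\<^sup>+ x. ennreal (\<bar>h x\<bar> powr (1 / c)) \<partial>M) \<le> ennreal (B powr (1 / c))"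
      using nrm_pos_le_iff[OF c, of B M h] by simp
    then show ?thesis
      using le real nrm_pos_le_iff[OF c, of B M f] by (auto intro: order_trans)
  qed simp
qed

lemma nrm_cong_AE:
  assumes "0 \<le> c" "AE x in M. \<bar>f x\<bar> = \<bar>h x\<bar>"
  shows "nrm M c f = nrm M c h"
  using assms by (intro antisym nrm_mono_AE) (auto elim: eventually_mono)

lemma nrm_eq_0_iff:
  assumes c: "0 \<le> c" and f: "f \<in> borel_measurable M"
  shows "nrm M c f = 0 \<longleftrightarrow> (AE x in M. f x = 0)"
proof (cases "c = 0")
  case True
  then show ?thesis
    using nrm_0_le_iff[of M f 0] by simp
next
  case False
  then have c: "0 < c" using c by simp
  have "nrm M c f = 0 \<longleftrightarrow> nrm M c f \<le> ennreal 0"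
    by simp
  also have "\<dots> \<longleftrightarrow> (\<integral>\<^sup>+ x. ennreal (\<bar>f x\<bar> powr (1 / c)) \<partial>M) = 0"
    using nrm_pos_le_iff[OF c, of 0 M f] by simp
  also have "\<dots> \<longleftrightarrow> (AE x in M. ennreal (\<bar>f x\<bar> powr (1 / c)) = 0)"
    using f by (intro nn_integral_0_iff_AE) simp
  finally show ?thesis
    by simp
qed

lemma nrm_cmult_le:
  assumes "0 \<le> c" "0 < k" "0 \<le> A" "nrm M c f \<le> ennreal A" "f \<in> borel_measurable M"
  shows "nrm M c (\<lambda>x. k * f x) \<le> ennreal (k * A)"
proof (cases "c = 0")
  case True
  then have "AE x in M. ennreal \<bar>f x\<bar> \<le> ennreal A"
    using assms nrm_0_le_iff by blast
  then have "AE x in M. ennreal \<bar>k * f x\<bar> \<le> ennreal (k * A)"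
    by eventually_elim (use assms in \<open>simp add: abs_mult\<close>)
  then show ?thesis
    using True nrm_0_le_iff by blast
next
  case False
  then have c: "0 < c" using assms by simp
  have "(\<integral>\<^sup>+ x. ennreal (\<bar>k * f x\<bar> powr (1 / c)) \<partial>M)
      = (\<integral>\<^sup>+ x. ennreal (k powr (1 / c)) * ennreal (\<bar>f x\<bar> powr (1 / c)) \<partial>M)"
    using assms by (simp add: abs_mult powr_mult ennreal_mult)
  also have "\<dots> = ennreal (k powr (1 / c)) * (\<integral>\<^sup>+ x. ennreal (\<bar>f x\<bar> powr (1 / c)) \<partial>M)"
    using assms by (intro nn_integral_cmult) simp
  also have "\<dots> \<le> ennreal (k powr (1 / c)) * ennreal (A powr (1 / c))"
    using assms c nrm_pos_le_iff[OF c, of A M f] by (intro mult_left_mono) auto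
  also have "\<dots> = ennreal ((k * A) powr (1 / c))"
    using assms by (simp add: powr_mult ennreal_mult)
  finally show ?thesis
    using c assms by (subst nrm_pos_le_iff) auto
qed

text \<open>The index scales with the power, and \<open>\<theta> = 0\<close> has to be covered
  because it occurs for an infinite target exponent. Then the function takes only the values 0 and 1
  (as \<open>0 powr 0 = 0\<close>), and \<open>0 < A\<close> makes the bound equal to 1.\<close>

lemma nrm_powr_le:
  assumes "0 \<le> c" "0 \<le> \<theta>" "0 < A" "nrm M c f \<le> ennreal A"
  shows "nrm M (\<theta> * c) (\<lambda>x. \<bar>f x\<bar> powr \<theta>) \<le> ennreal (A powr \<theta>)"
proof -
  consider "c = 0" | "\<theta> = 0" | "0 < c" "0 < \<theta>"
    using assms by force
  then show ?thesis
  proof cases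
    case 1
    then have "AE x in M. ennreal \<bar>f x\<bar> \<le> ennreal A"
      using assms nrm_0_le_iff by blast
    then have "AE x in M. ennreal \<bar>\<bar>f x\<bar> powr \<theta>\<bar> \<le> ennreal (A powr \<theta>)"
      by eventually_elim (use assms in \<open>auto intro!: ennreal_leI powr_mono2\<close>)
    then show ?thesis
      using 1 by (simp add: nrm_0_le_iff)
  next
    case 2
    then show ?thesis
      using assms by (auto simp: nrm_0_le_iff intro!: AE_I2)
  next
    case 3
    then show ?thesis
      using assms nrm_pos_le_iff[of c A M f]
      by (subst nrm_pos_le_iff) (auto simp: powr_powr)
  qed
qed

section \<open>Hoelder's inequality and its converse\<close>

text \<open>The second factor has norm at most \<open>B powr g\<close> at index \<open>g\<close>.
  After both factors are normalised by their bounds, the weighted arithmetic-geometric mean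
  inequality holds pointwise and is integrated. The cases \<open>A = 0\<close> and
  \<open>c = 0\<close> are separate, since the normalisation divides by \<open>A\<close> and the
  exponent \<open>1 / c\<close> is used.\<close>

lemma Holder_nrm:
  assumes c: "0 \<le> c" and g: "0 < g" and A: "0 \<le> A" and B: "0 < B"
    and f: "f \<in> borel_measurable M" and G: "G \<in> borel_measurable M"
    and G0: "\<And>x. x \<in> space M \<Longrightarrow> 0 \<le> G x"
    and nf: "nrm M c f \<le> ennreal A" and nG: "(\<integral>\<^sup>+ x. ennreal (G x) \<partial>M) \<le> ennreal B"
  shows "nrm M (c + g) (\<lambda>x. f x * G x powr g) \<le> ennreal (A * B powr g)"
proof -
  consider "A = 0" | "c = 0" "0 < A" | "0 < c" "0 < A"
    using c A by force
  then show ?thesis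
  proof cases
    case 1
    then have "AE x in M. f x = 0"
      using nf nrm_eq_0_iff[OF c f] by simp
    then have "AE x in M. f x * G x powr g = 0"
      by eventually_elim simp
    then have "nrm M (c + g) (\<lambda>x. f x * G x powr g) = 0"
      using c g f G by (subst nrm_eq_0_iff) auto
    then show ?thesis by simp
  next
    case 2
    then have "AE x in M. ennreal \<bar>f x\<bar> \<le> ennreal A"
      using nf nrm_0_le_iff by blast
    then have "AE x in M. ennreal (\<bar>f x * G x powr g\<bar> powr (1 / g))
        \<le> ennreal (A powr (1 / g)) * ennreal (G x)"
      using AE_space
    proof eventually_elim
      case (elim x)
      have "\<bar>f x * G x powr g\<bar> powr (1 / g) = \<bar>f x\<bar> powr (1 / g) * G x"
        using g G0[of x] elim by (simp add: abs_mult powr_mult powr_powr)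
      also have "\<dots> \<le> A powr (1 / g) * G x"
        using elim G0[of x] g A by (intro mult_right_mono powr_mono2) auto
      finally show ?case
        using G0[of x] elim by (simp add: ennreal_mult'[symmetric] ennreal_leI)
    qed
    then have "(\<integral>\<^sup>+ x. ennreal (\<bar>f x * G x powr g\<bar> powr (1 / g)) \<partial>M)
        \<le> (\<integral>\<^sup>+ x. ennreal (A powr (1 / g)) * ennreal (G x) \<partial>M)"
      by (rule nn_integral_mono_AE)
    also have "\<dots> = ennreal (A powr (1 / g)) * (\<integral>\<^sup>+ x. ennreal (G x) \<partial>M)"
      using G by (intro nn_integral_cmult) simp
    also have "\<dots> \<le> ennreal (A powr (1 / g)) * ennreal B"
      using nG by (intro mult_left_mono) auto
    also have "\<dots> = ennreal ((A * B powr g) powr (1 / g))"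
      using 2 g B by (simp add: powr_mult powr_powr ennreal_mult)
    finally show ?thesis
      using 2 g B by (subst nrm_pos_le_iff) auto
  next
    case 3
    define r where "r = 1 / (c + g)"
    have r: "0 < r" "c * r + g * r = 1"
      using 3 g by (auto simp: r_def add_divide_distrib[symmetric])
    \<comment> \<open>This is the target value \<open>(A * B powr g) powr r\<close>. Young's
      inequality with weights \<open>c * r\<close> and \<open>g * r\<close> bounds the integral by
      \<open>K * (c * r + g * r)\<close>, and the weights add up to 1.\<close>
    define K where "K = A powr r * B powr (g * r)"
    have K: "0 < K" using 3 B by (simp add: K_def)
    have nf': "(\<integral>\<^sup>+ x. ennreal (\<bar>f x\<bar> powr (1 / c)) \<partial>M) \<le> ennreal (A powr (1 / c))"
      using nf nrm_pos_le_iff[of c A M f] 3 by simp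
    have *: "ennreal (\<bar>f x * G x powr g\<bar> powr r)
        \<le> ennreal (K * (c * r / A powr (1 / c))) * ennreal (\<bar>f x\<bar> powr (1 / c))
          + ennreal (K * (g * r / B)) * ennreal (G x)" if x: "x \<in> space M" for x
    proof -
      let ?X = "\<bar>f x\<bar> powr (1 / c) / A powr (1 / c)" and ?Y = "G x / B"
      have "\<bar>f x * G x powr g\<bar> powr r = K * (?X powr (c * r) * ?Y powr (g * r))"
        using 3 G0[OF x] B g
        by (simp add: K_def abs_mult powr_mult powr_powr powr_divide)
      also have "?X powr (c * r) * ?Y powr (g * r) \<le> c * r * ?X + g * r * ?Y"
      \<comment> \<open>Young's inequality is applied to positive arguments; if one argument
        vanishes, so does the left side.\<close>
      proof (cases "?X = 0 \<or> ?Y = 0")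
        case True
        moreover have "0 \<le> c * r * ?X + g * r * ?Y"
          using 3 g r G0[OF x] B by simp
        ultimately show ?thesis by auto
      next
        case False
        then show ?thesis
          using 3 g r G0[OF x] B
          by (intro Youngs_inequality_0) (auto simp: less_le)
      qed
      finally have "\<bar>f x * G x powr g\<bar> powr r
          \<le> K * (c * r / A powr (1 / c)) * (\<bar>f x\<bar> powr (1 / c)) + K * (g * r / B) * G x"
        using K by (simp add: algebra_simps)
      then show ?thesis
        using 3 r g K G0[OF x] B
        by (simp add: ennreal_mult'[symmetric] ennreal_plus[symmetric] ennreal_leI del: ennreal_plus)
    qed
    have "(\<integral>\<^sup>+ x. ennreal (\<bar>f x * G x powr g\<bar> powr r) \<partial>M)
        \<le> (\<integral>\<^sup>+ x. ennreal (K * (c * r / A powr (1 / c))) * ennreal (\<bar>f x\<bar> powr (1 / c))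
          + ennreal (K * (g * r / B)) * ennreal (G x) \<partial>M)"
      by (intro nn_integral_mono *)
    also have "\<dots> = ennreal (K * (c * r / A powr (1 / c))) * (\<integral>\<^sup>+ x. ennreal (\<bar>f x\<bar> powr (1 / c)) \<partial>M)
          + ennreal (K * (g * r / B)) * (\<integral>\<^sup>+ x. ennreal (G x) \<partial>M)"
      using f G by (subst nn_integral_add) (auto simp: nn_integral_cmult)
    also have "\<dots> \<le> ennreal (K * (c * r / A powr (1 / c))) * ennreal (A powr (1 / c))
          + ennreal (K * (g * r / B)) * ennreal B"
      using nf' nG by (intro add_mono mult_left_mono) auto
    also have "\<dots> = ennreal (K * (c * r + g * r))"
      using 3 g r(1) K B
      by (simp add: ennreal_mult'[symmetric] ennreal_plus[symmetric] algebra_simps del: ennreal_plus)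
    also have "\<dots> = ennreal ((A * B powr g) powr r)"
      using r 3 B by (simp add: K_def powr_mult powr_powr)
    finally show ?thesis
      unfolding r_def using 3 g B by (subst nrm_pos_le_iff) auto
  qed
qed

text \<open>Converse of Hoelder: a bound that is uniform over all F with integral at most 1 controls
  the norm of H at the lower index. Finiteness of that norm is not presupposed, so the test
  functions live on sets where they can be normalised.\<close>

lemma nrm_duality:
  assumes sf: "sigma_finite_measure M" and c: "0 \<le> c" and b: "0 < b" and X: "0 \<le> X"
    and H: "H \<in> borel_measurable M"
    and dual: "\<And>F. F \<in> borel_measurable M \<Longrightarrow> (\<And>x. 0 \<le> F x) \<Longrightarrow> (\<integral>\<^sup>+ x. ennreal (F x) \<partial>M) \<le> 1
      \<Longrightarrow> nrm M (c + b) (\<lambda>x. H x * F x powr b) \<le> ennreal X"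
  shows "nrm M c H \<le> ennreal X"
proof -
  interpret sigma_finite_measure M by fact
  obtain A :: "nat \<Rightarrow> 'a set" where A: "range A \<subseteq> sets M" "(\<Union>i. A i) = space M"
    "\<And>i. emeasure M (A i) \<noteq> \<infinity>" "incseq A"
    using sigma_finite_incseq by blast
  have A_sets [measurable]: "A i \<in> sets M" for i
    using A by auto
  note H [measurable]
  show ?thesis
  proof (cases "c = 0")
    case True
    have "emeasure M {x \<in> A i. X + 1 / Suc n \<le> \<bar>H x\<bar>} = 0" for i n :: nat
    proof (rule ccontr)
      define E where "E = {x \<in> A i. X + 1 / Suc n \<le> \<bar>H x\<bar>}"
      define l where "l = X + 1 / Suc n"
      assume "emeasure M {x \<in> A i. X + 1 / Suc n \<le> \<bar>H x\<bar>} \<noteq> 0"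
      then have E0: "emeasure M E \<noteq> 0" by (simp add: E_def)
      have [measurable]: "E \<in> sets M"
      proof -
        have "E = A i \<inter> {x \<in> space M. X + 1 / Suc n \<le> \<bar>H x\<bar>}"
          using sets.sets_into_space[OF A_sets[of i]] by (auto simp: E_def)
        then show ?thesis by simp
      qed
      have "emeasure M E \<le> emeasure M (A i)"
        by (intro emeasure_mono) (auto simp: E_def)
      then have Efin: "emeasure M E < \<infinity>"
        using A(3)[of i] by (simp add: less_top top_unique order_le_less_trans)
      define e where "e = measure M E"
      have e: "emeasure M E = ennreal e" "0 < e"
        using E0 Efin by (auto simp: e_def emeasure_eq_ennreal_measure zero_less_measure_iff)
      \<comment> \<open>A normalised indicator of a set where \<open>\<bar>H\<bar>\<close> is at
        least \<open>l > X\<close>: its test integral is at least \<open>l powr (1 / b)\<close>,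
        which contradicts the assumed bound.\<close>
      define F where "F = (\<lambda>x. indicator E x / e :: real)"
      have F_int: "(\<integral>\<^sup>+ x. ennreal (F x) \<partial>M) = 1"
      proof -
        have "(\<integral>\<^sup>+ x. ennreal (F x) \<partial>M) = (\<integral>\<^sup>+ x. ennreal (1 / e) * indicator E x \<partial>M)"
          by (intro nn_integral_cong) (auto simp: F_def split: split_indicator)
        also have "\<dots> = ennreal (1 / e) * ennreal e"
          by (simp add: nn_integral_cmult_indicator e)
        also have "\<dots> = 1"
          using e by (simp add: ennreal_mult'[symmetric])
        finally show ?thesis .
      qed
      have "nrm M b (\<lambda>x. H x * F x powr b) \<le> ennreal X"
        using dual[of F] F_int e True by (simp add: F_def)
      then have "(\<integral>\<^sup>+ x. ennreal (\<bar>H x * F x powr b\<bar> powr (1 / b)) \<partial>M) \<le> ennreal (X powr (1 / b))"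
        by (rule iffD1[OF nrm_pos_le_iff[OF b X]])
      moreover have "(\<integral>\<^sup>+ x. ennreal (l powr (1 / b) / e) * indicator E x \<partial>M)
          \<le> (\<integral>\<^sup>+ x. ennreal (\<bar>H x * F x powr b\<bar> powr (1 / b)) \<partial>M)"
      proof (intro nn_integral_mono)
        fix x
        show "ennreal (l powr (1 / b) / e) * indicator E x \<le> ennreal (\<bar>H x * F x powr b\<bar> powr (1 / b))"
        proof (cases "x \<in> E")
          case True
          then have "l powr (1 / b) \<le> \<bar>H x\<bar> powr (1 / b)"
            using b X by (intro powr_mono2) (auto simp: E_def l_def)
          then show ?thesis
            using True b e by (simp add: F_def abs_mult powr_mult powr_powr ennreal_leI divide_right_mono)
        qed simp
      qed
      moreover have "(\<integral>\<^sup>+ x. ennreal (l powr (1 / b) / e) * indicator E x \<partial>M) = ennreal (l powr (1 / b))"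
        using e by (simp add: nn_integral_cmult_indicator ennreal_mult'[symmetric])
      ultimately have "ennreal (l powr (1 / b)) \<le> ennreal (X powr (1 / b))"
        by (metis order_trans)
      moreover have "X powr (1 / b) < l powr (1 / b)"
        using b X by (intro powr_less_mono2) (auto simp: l_def)
      ultimately show False by simp
    qed
    then have *: "AE x in M. x \<notin> {x \<in> A i. X + 1 / Suc n \<le> \<bar>H x\<bar>}" for i n
    proof (intro AE_not_in null_setsI)
      have "{x \<in> A i. X + 1 / Suc n \<le> \<bar>H x\<bar>} = A i \<inter> {x \<in> space M. X + 1 / Suc n \<le> \<bar>H x\<bar>}"
        using sets.sets_into_space[OF A_sets[of i]] by auto
      then show "{x \<in> A i. X + 1 / Suc n \<le> \<bar>H x\<bar>} \<in> sets M" by simp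
    qed
    have "AE x in M. \<forall>i n. x \<notin> {x \<in> A i. X + 1 / Suc n \<le> \<bar>H x\<bar>}"
      unfolding AE_all_countable using * by blast
    then have "AE x in M. ennreal \<bar>H x\<bar> \<le> ennreal X"
      using AE_space
    proof eventually_elim
      case (elim x)
      then obtain i where "x \<in> A i" using A(2) by blast
      have "\<bar>H x\<bar> \<le> X"
      proof (rule ccontr)
        assume "\<not> \<bar>H x\<bar> \<le> X"
        then have "0 < \<bar>H x\<bar> - X" by simp
        then obtain n where "inverse (real (Suc n)) < \<bar>H x\<bar> - X"
          using reals_Archimedean by blast
        then have "X + 1 / Suc n \<le> \<bar>H x\<bar>"
          by (simp add: inverse_eq_divide)
        then show False
          using elim \<open>x \<in> A i\<close> by blast
      qed
      then show ?case by (simp add: ennreal_leI)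
    qed
    then show ?thesis
      using True nrm_0_le_iff by blast
  next
    case False
    then have c: "0 < c" using c by simp
    define r where "r = 1 / (c + b)"
    have "(1 + b / c) * r = (c + b) / c * r"
      using c by (simp add: add_divide_distrib)
    then have r: "0 < r" "c * r + b * r = 1" "(1 + b / c) * r = 1 / c"
      using c b by (auto simp: r_def add_divide_distrib[symmetric])
    \<comment> \<open>On these sets H is bounded and the measure is finite, so the integral of
      \<open>h\<close> is finite and can serve as a normalising constant.\<close>
    define E where "E = (\<lambda>n::nat. A n \<inter> {x \<in> space M. \<bar>H x\<bar> \<le> real n})"
    have E_sets [measurable]: "E n \<in> sets M" for n
      unfolding E_def by simp
    define h where "h = (\<lambda>x. \<bar>H x\<bar> powr (1 / c))"
    have h_meas [measurable]: "h \<in> borel_measurable M" unfolding h_def by simp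
    have bound: "(\<integral>\<^sup>+ x. ennreal (h x) * indicator (E n) x \<partial>M) \<le> ennreal (X powr (1 / c))" for n
    proof -
      let ?I = "\<integral>\<^sup>+ x. ennreal (h x) * indicator (E n) x \<partial>M"
      have "?I \<le> (\<integral>\<^sup>+ x. ennreal (real n powr (1 / c)) * indicator (A n) x \<partial>M)"
        using c by (intro nn_integral_mono)
          (auto simp: h_def E_def intro!: ennreal_leI powr_mono2 split: split_indicator)
      also have "\<dots> < \<infinity>"
        using A(3)[of n] by (simp add: nn_integral_cmult_indicator ennreal_mult_less_top less_top)
      finally obtain i where i: "?I = ennreal i" "0 \<le> i"
        by (cases ?I) auto
      show ?thesis
      proof (cases "i = 0")
        case False
        then have i0: "0 < i" using i by simp
        \<comment> \<open>The equality case of Hoelder: with F proportional to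
          \<open>\<bar>H\<bar> powr (1 / c)\<close>, the tested function raised to the power
          \<open>r\<close> is again a multiple of \<open>\<bar>H\<bar> powr (1 / c)\<close>.\<close>
        define F where "F = (\<lambda>x. h x * indicator (E n) x / i)"
        have F: "F \<in> borel_measurable M" "0 \<le> F x" for x
          unfolding F_def using i0 by (simp_all add: h_def)
        have "(\<integral>\<^sup>+ x. ennreal (F x) \<partial>M) = (\<integral>\<^sup>+ x. ennreal (1 / i) * (ennreal (h x) * indicator (E n) x) \<partial>M)"
          using i0 by (intro nn_integral_cong)
            (auto simp: F_def h_def ennreal_mult'[symmetric] split: split_indicator)
        also have "\<dots> = ennreal (1 / i) * ennreal i"
          by (simp add: nn_integral_cmult i)
        also have "\<dots> = 1"
          using i0 by (simp add: ennreal_mult'[symmetric])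
        finally have "nrm M (c + b) (\<lambda>x. H x * F x powr b) \<le> ennreal X"
          using dual[OF F] by simp
        then have le: "(\<integral>\<^sup>+ x. ennreal (\<bar>H x * F x powr b\<bar> powr r) \<partial>M) \<le> ennreal (X powr r)"
          using nrm_pos_le_iff[of "c + b" X M] b X c by (simp add: r_def)
        have "(\<integral>\<^sup>+ x. ennreal (\<bar>H x * F x powr b\<bar> powr r) \<partial>M)
            = (\<integral>\<^sup>+ x. ennreal (i powr (- b * r)) * (ennreal (h x) * indicator (E n) x) \<partial>M)"
        proof (intro nn_integral_cong)
          fix x
          show "ennreal (\<bar>H x * F x powr b\<bar> powr r) = ennreal (i powr (- b * r)) * (ennreal (h x) * indicator (E n) x)"
          proof (cases "x \<in> E n \<and> H x \<noteq> 0")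
            case True
            have "\<bar>H x * F x powr b\<bar> powr r = (\<bar>H x\<bar> * (\<bar>H x\<bar> powr (b / c) / i powr b)) powr r"
              using True i0 by (simp add: F_def h_def abs_mult powr_divide powr_powr)
            also have "\<dots> = (\<bar>H x\<bar> powr (1 + b / c) / i powr b) powr r"
              using True by (simp add: powr_add)
            also have "\<dots> = \<bar>H x\<bar> powr ((1 + b / c) * r) * i powr (- b * r)"
              using i0 by (simp add: powr_divide powr_powr powr_minus_divide)
            also have "\<dots> = i powr (- b * r) * h x"
              by (simp add: r h_def)
            finally show ?thesis
              using True i0 by (simp add: ennreal_mult'[symmetric])
          next
            case False
            then show ?thesis
              using b r by (auto simp: F_def h_def split: split_indicator)
          qed
        qed
        also have "\<dots> = ennreal (i powr (- b * r)) * ennreal i"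
          by (simp add: nn_integral_cmult i)
        also have "\<dots> = ennreal (i powr (c * r))"
        proof -
          have "c * r = - b * r + 1"
            using r by simp
          then have "i powr (c * r) = i powr (- b * r + 1)"
            by (rule arg_cong)
          also have "\<dots> = i powr (- b * r) * i"
            using i0 by (subst powr_add) simp
          finally show ?thesis
            using i0 by (simp add: ennreal_mult'[symmetric])
        qed
        \<comment> \<open>Since \<open>c * r + b * r = 1\<close>, the test integral is a pure power
          of \<open>i\<close>. Taking the root bounds \<open>i\<close> independently of
          \<open>n\<close>, and monotone convergence then removes the truncation.\<close>
        finally have "i powr (c * r) \<le> X powr r"
          using le by simp
        then have "(i powr (c * r)) powr (1 / (c * r)) \<le> (X powr r) powr (1 / (c * r))"
          using c r by (intro powr_mono2) auto
        then have "i \<le> X powr (1 / c)"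
          using c r i0 by (simp add: powr_powr)
        then show ?thesis
          using i by (simp add: ennreal_leI)
      qed (simp add: i)
    qed
    have incE: "incseq E"
      using A(4) by (fastforce simp: incseq_def E_def)
    have "(\<integral>\<^sup>+ x. ennreal (h x) \<partial>M) = (\<integral>\<^sup>+ x. (SUP n. ennreal (h x) * indicator (E n) x) \<partial>M)"
    proof (intro nn_integral_cong antisym)
      fix x assume x: "x \<in> space M"
      then obtain k where k: "x \<in> A k" using A(2) by blast
      obtain l :: nat where l: "\<bar>H x\<bar> \<le> real l" using real_arch_simple by blast
      have "x \<in> A (max k l)"
        using k incseqD[OF A(4), of k "max k l"] by auto
      then have "x \<in> E (max k l)"
        using l x by (auto simp: E_def)
      then have "ennreal (h x) = ennreal (h x) * indicator (E (max k l)) x" by simp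
      also have "\<dots> \<le> (SUP n. ennreal (h x) * indicator (E n) x)"
        by (intro SUP_upper) simp
      finally show "ennreal (h x) \<le> (SUP n. ennreal (h x) * indicator (E n) x)" .
      show "(SUP n. ennreal (h x) * indicator (E n) x) \<le> ennreal (h x)"
        by (intro SUP_least) (auto split: split_indicator)
    qed
    also have "\<dots> = (SUP n. \<integral>\<^sup>+ x. ennreal (h x) * indicator (E n) x \<partial>M)"
      using incE by (intro nn_integral_monotone_convergence_SUP)
        (auto simp: incseq_def le_fun_def split: split_indicator)
    also have "\<dots> \<le> ennreal (X powr (1 / c))"
      by (intro SUP_least bound)
    finally show ?thesis
      using c X by (subst nrm_pos_le_iff) (auto simp: h_def)
  qed
qed

section \<open>The maximal operator and the Rubio de Francia iteration\<close>

lemma maxop_measurable: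
  assumes "basis_of_sets M \<U>" "f \<in> borel_measurable M"
  shows "maxop M \<U> f \<in> borel_measurable M"
proof -
  have "(\<lambda>x. ennreal (1 / measure M U) * (\<integral>\<^sup>+ y\<in>U. ennreal \<bar>f y\<bar> \<partial>M) * indicator U x)
      \<in> borel_measurable M" if "U \<in> \<U>" for U
  proof -
    have [measurable]: "U \<in> sets M"
      using assms that by (auto simp: basis_of_sets_def)
    show ?thesis by measurable
  qed
  then have "(\<lambda>x. SUP U\<in>\<U>. ennreal (1 / measure M U) * (\<integral>\<^sup>+ y\<in>U. ennreal \<bar>f y\<bar> \<partial>M) * indicator U x)
      \<in> borel_measurable M"
    using assms by (intro borel_measurable_SUP) (auto simp: basis_of_sets_def)
  then show ?thesis
    by (simp add: maxop_def[abs_def])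
qed

lemma basis_measure_pos:
  assumes "basis_of_sets M \<U>" "U \<in> \<U>"
  shows "U \<in> sets M" "0 < measure M U" "emeasure M U = ennreal (measure M U)"
  using assms by (auto simp: basis_of_sets_def emeasure_eq_ennreal_measure zero_less_measure_iff)

lemma average_le_maxop:
  assumes "U \<in> \<U>" "x \<in> U"
  shows "ennreal (1 / measure M U) * (\<integral>\<^sup>+ y\<in>U. ennreal \<bar>f y\<bar> \<partial>M) \<le> maxop M \<U> f x"
  using SUP_upper[OF assms(1), of "\<lambda>U. ennreal (1 / measure M U) * (\<integral>\<^sup>+ y\<in>U. ennreal \<bar>f y\<bar> \<partial>M) * indicator U x"] assms(2)
  by (simp add: maxop_def)

text \<open>If the maximal function vanished at x, then f would vanish almost everywhere on each
  basis set through x. These sets are countably many, and they cover the space because any two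
  points share a basis set.\<close>

lemma maxop_pos:
  assumes basis: "basis_of_sets M \<U>" and f [measurable]: "f \<in> borel_measurable M"
    and nz: "\<not> (AE x in M. f x = 0)" and x: "x \<in> space M"
  shows "0 < maxop M \<U> f x"
proof (rule ccontr)
  assume "\<not> 0 < maxop M \<U> f x"
  then have z: "maxop M \<U> f x = 0" by simp
  have "AE y in M. y \<in> U \<longrightarrow> f y = 0" if U: "U \<in> {U \<in> \<U>. x \<in> U}" for U
  proof -
    note [measurable] = basis_measure_pos(1)[OF basis, of U]
    have "ennreal (1 / measure M U) * (\<integral>\<^sup>+ y\<in>U. ennreal \<bar>f y\<bar> \<partial>M) = 0"
      using average_le_maxop[of U \<U> x M f] U z by simp
    then have "(\<integral>\<^sup>+ y\<in>U. ennreal \<bar>f y\<bar> \<partial>M) = 0"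
      using basis_measure_pos(2)[OF basis, of U] U by (auto simp: divide_le_0_iff)
    then have "AE y in M. ennreal \<bar>f y\<bar> * indicator U y = 0"
      using U by (subst (asm) nn_integral_0_iff_AE) auto
    then show ?thesis
      by eventually_elim (auto split: split_indicator_asm)
  qed
  moreover have "countable {U \<in> \<U>. x \<in> U}"
    using basis by (auto simp: basis_of_sets_def)
  ultimately have "AE y in M. \<forall>U\<in>{U \<in> \<U>. x \<in> U}. y \<in> U \<longrightarrow> f y = 0"
    by (subst AE_ball_countable) auto
  then have "AE y in M. f y = 0"
    using AE_space
  proof eventually_elim
    case (elim y)
    then show ?case
      using basis x unfolding basis_of_sets_def by blast
  qed
  then show False using nz by blast
qed

text \<open>The operator norm is a supremum over the unit ball; homogeneity carries it to functions
  of arbitrary size.\<close>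

lemma maxop_scale:
  assumes "0 < l" "f \<in> borel_measurable M" "basis_of_sets M \<U>"
  shows "maxop M \<U> f x = ennreal l * maxop M \<U> (\<lambda>x. f x / l) x"
proof -
  have "(\<integral>\<^sup>+ y\<in>U. ennreal \<bar>f y\<bar> \<partial>M) = ennreal l * (\<integral>\<^sup>+ y\<in>U. ennreal \<bar>f y / l\<bar> \<partial>M)" if "U \<in> \<U>" for U
  proof -
    have [measurable]: "U \<in> sets M" "f \<in> borel_measurable M"
      using assms that by (auto simp: basis_of_sets_def)
    have "(\<integral>\<^sup>+ y\<in>U. ennreal \<bar>f y\<bar> \<partial>M) = (\<integral>\<^sup>+ y. ennreal l * (ennreal \<bar>f y / l\<bar> * indicator U y) \<partial>M)"
      using assms by (intro nn_integral_cong) (auto simp: ennreal_mult'[symmetric] split: split_indicator)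
    also have "\<dots> = ennreal l * (\<integral>\<^sup>+ y\<in>U. ennreal \<bar>f y / l\<bar> \<partial>M)"
      by (intro nn_integral_cmult) simp
    finally show ?thesis .
  qed
  then have "maxop M \<U> f x = (SUP U\<in>\<U>. ennreal l * (ennreal (1 / measure M U)
      * (\<integral>\<^sup>+ y\<in>U. ennreal \<bar>f y / l\<bar> \<partial>M) * indicator U x))"
    unfolding maxop_def by (intro SUP_cong) (auto simp: mult_ac)
  also have "\<dots> = ennreal l * maxop M \<U> (\<lambda>x. f x / l) x"
    unfolding maxop_def by (simp add: SUP_mult_left_ennreal)
  finally show ?thesis .
qed

lemma epow_cmult: "0 < l \<Longrightarrow> epow (ennreal l * y) t = ennreal (l powr t) * epow y t"
  by (cases y) (auto simp: epow_def ennreal_mult_eq_top_iff enn2real_mult powr_mult ennreal_mult' top_ennreal.rep_eq)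

text \<open>The first conclusion follows from the integral bound because w is positive. It justifies
  passing from the extended-valued maximal function to its \<open>enn2real\<close>, so that the
  operator can be iterated on real functions.\<close>

lemma maxop_bound:
  assumes basis: "basis_of_sets M \<U>" and t: "0 < t" and v: "weight M v" and w: "weight M w"
    and N: "maxop_norm M \<U> (ennreal t) v w \<le> ennreal N" "0 \<le> N"
    and l: "0 < l" and f: "f \<in> borel_measurable M"
    and fl: "(\<integral>\<^sup>+ x. ennreal ((\<bar>f x\<bar> * v x) powr t) \<partial>M) \<le> ennreal (l powr t)"
  shows "AE x in M. maxop M \<U> f x < \<infinity>"
    and "(\<integral>\<^sup>+ x. ennreal ((enn2real (maxop M \<U> f x) * w x) powr t) \<partial>M) \<le> ennreal ((l * N) powr t)"
proof -
  have [measurable]: "f \<in> borel_measurable M" "v \<in> borel_measurable M" "w \<in> borel_measurable M"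
    "maxop M \<U> f \<in> borel_measurable M" "maxop M \<U> (\<lambda>x. f x / l) \<in> borel_measurable M"
    using v w f basis by (auto simp: weight_def intro!: maxop_measurable)
  have v0: "0 < v x" and w0: "0 < w x" if "x \<in> space M" for x
    using that v w by (auto simp: weight_def)
  have enorm_t: "enorm M (ennreal t) h \<le> ennreal B
      \<longleftrightarrow> (\<integral>\<^sup>+ x. epow (h x) t \<partial>M) \<le> ennreal (B powr t)" if "0 \<le> B" for h B
    using t epow_le_iff[of "1 / t" B] that by (simp add: enorm_def)
  have "(\<integral>\<^sup>+ x. ennreal (\<bar>f x / l * v x\<bar> powr t) \<partial>M)
      = (\<integral>\<^sup>+ x. ennreal (l powr (- t)) * ennreal ((\<bar>f x\<bar> * v x) powr t) \<partial>M)"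
  proof (intro nn_integral_cong)
    fix x assume "x \<in> space M"
    then show "ennreal (\<bar>f x / l * v x\<bar> powr t) = ennreal (l powr (- t)) * ennreal ((\<bar>f x\<bar> * v x) powr t)"
      using v0[of x] l
      by (simp add: ennreal_mult'[symmetric] abs_mult powr_mult powr_divide powr_minus_divide)
  qed
  also have "\<dots> = ennreal (l powr (- t)) * (\<integral>\<^sup>+ x. ennreal ((\<bar>f x\<bar> * v x) powr t) \<partial>M)"
    by (intro nn_integral_cmult) simp
  also have "\<dots> \<le> ennreal (l powr (- t)) * ennreal (l powr t)"
    by (intro mult_left_mono fl) simp
  also have "\<dots> = ennreal (1 powr t)"
    using l by (simp add: ennreal_mult'[symmetric] powr_minus_divide)
  finally have "Lpw M (ennreal t) v (\<lambda>x. f x / l) \<le> 1"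
    using enorm_t[of 1] t by (simp add: Lpw_def Lpn_def)
  then have "enorm M (ennreal t) (\<lambda>x. maxop M \<U> (\<lambda>x. f x / l) x * ennreal (w x)) \<le> maxop_norm M \<U> (ennreal t) v w"
    unfolding maxop_norm_def by (intro SUP_upper) simp
  then have "enorm M (ennreal t) (\<lambda>x. maxop M \<U> (\<lambda>x. f x / l) x * ennreal (w x)) \<le> ennreal N"
    using N by simp
  then have b1: "(\<integral>\<^sup>+ x. epow (maxop M \<U> (\<lambda>x. f x / l) x * ennreal (w x)) t \<partial>M) \<le> ennreal (N powr t)"
    using enorm_t N by simp
  have meas: "(\<lambda>x. epow (maxop M \<U> (\<lambda>x. f x / l) x * ennreal (w x)) t) \<in> borel_measurable M"
    unfolding epow_def by measurable
  have eq: "epow (maxop M \<U> f x * ennreal (w x)) t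
      = ennreal (l powr t) * epow (maxop M \<U> (\<lambda>x. f x / l) x * ennreal (w x)) t" for x
    using epow_cmult[OF l] maxop_scale[OF l f basis] by (simp add: mult.assoc)
  have b: "(\<integral>\<^sup>+ x. epow (maxop M \<U> f x * ennreal (w x)) t \<partial>M) \<le> ennreal ((l * N) powr t)"
  proof -
    have "(\<integral>\<^sup>+ x. epow (maxop M \<U> f x * ennreal (w x)) t \<partial>M)
       = ennreal (l powr t) * (\<integral>\<^sup>+ x. epow (maxop M \<U> (\<lambda>x. f x / l) x * ennreal (w x)) t \<partial>M)"
      unfolding eq by (intro nn_integral_cmult meas)
    also have "\<dots> \<le> ennreal (l powr t) * ennreal (N powr t)"
      by (intro mult_left_mono b1) simp
    also have "\<dots> = ennreal ((l * N) powr t)"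
      using l N by (simp add: ennreal_mult'[symmetric] powr_mult)
    finally show ?thesis .
  qed
  have "AE x in M. epow (maxop M \<U> f x * ennreal (w x)) t \<noteq> \<infinity>"
  proof (rule nn_integral_PInf_AE)
    show "(\<lambda>x. epow (maxop M \<U> f x * ennreal (w x)) t) \<in> borel_measurable M"
      unfolding epow_def by measurable
    show "(\<integral>\<^sup>+ x. epow (maxop M \<U> f x * ennreal (w x)) t \<partial>M) \<noteq> \<infinity>"
      using b by (auto simp: top_unique)
  qed
  then show fin: "AE x in M. maxop M \<U> f x < \<infinity>"
    using AE_space
  proof eventually_elim
    case (elim x)
    then show ?case
      using w0[of x] by (auto simp: epow_def ennreal_top_mult simp flip: less_top)
  qed
  have "AE x in M. ennreal ((enn2real (maxop M \<U> f x) * w x) powr t) = epow (maxop M \<U> f x * ennreal (w x)) t"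
    using fin AE_space
  proof eventually_elim
    case (elim x)
    then show ?case
      using w0[of x] by (cases "maxop M \<U> f x") (auto simp: ennreal_mult'[symmetric])
  qed
  then have "(\<integral>\<^sup>+ x. ennreal ((enn2real (maxop M \<U> f x) * w x) powr t) \<partial>M)
      = (\<integral>\<^sup>+ x. epow (maxop M \<U> f x * ennreal (w x)) t \<partial>M)"
    by (rule nn_integral_cong_AE)
  then show "(\<integral>\<^sup>+ x. ennreal ((enn2real (maxop M \<U> f x) * w x) powr t) \<partial>M) \<le> ennreal ((l * N) powr t)"
    using b by simp
qed

section \<open>Summing a geometric sequence of functions\<close>

text \<open>With \<open>s\<close> the weighted sum, Young's inequality for
  \<open>a i * s powr (t - 1)\<close> is averaged with the weights \<open>c i\<close>; the multiple
  of \<open>s powr t\<close> on the right is then absorbed. Total mass below 1 only strengthens the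
  estimate.\<close>

lemma Jensen_powr_sum:
  fixes c a :: "'i \<Rightarrow> real"
  assumes "finite I" "\<And>i. i \<in> I \<Longrightarrow> 0 \<le> c i" "\<And>i. i \<in> I \<Longrightarrow> 0 \<le> a i" "(\<Sum>i\<in>I. c i) \<le> 1" "1 \<le> t"
  shows "(\<Sum>i\<in>I. c i * a i) powr t \<le> (\<Sum>i\<in>I. c i * a i powr t)"
proof -
  define s where "s = (\<Sum>i\<in>I. c i * a i)"
  have s0: "0 \<le> s" unfolding s_def using assms by (intro sum_nonneg) auto
  show ?thesis
  proof (cases "s = 0")
    case True
    then show ?thesis
      using assms by (auto simp: s_def intro!: sum_nonneg)
  next
    case False
    then have s: "0 < s" using s0 by simp
    have young: "a i * s powr (t - 1) \<le> 1 / t * a i powr t + (1 - 1 / t) * s powr t" if "i \<in> I" for i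
    proof (cases "a i = 0")
      case True
      then show ?thesis using assms by simp
    next
      case False
      then have "0 < a i" using assms(3)[OF that] by simp
      then have "(a i powr t) powr (1 / t) * (s powr t) powr (1 - 1 / t)
          \<le> 1 / t * a i powr t + (1 - 1 / t) * s powr t"
        using s assms by (intro Youngs_inequality_0) auto
      moreover have "t * (1 - 1 / t) = t - 1"
        using assms by (simp add: algebra_simps)
      ultimately show ?thesis
        using \<open>0 < a i\<close> assms by (simp add: powr_powr)
    qed
    have "s powr t = s * s powr (t - 1)"
      using s by (simp add: powr_diff)
    also have "\<dots> = (\<Sum>i\<in>I. c i * (a i * s powr (t - 1)))"
      by (simp add: s_def sum_distrib_right mult.assoc)
    also have "\<dots> \<le> (\<Sum>i\<in>I. c i * (1 / t * a i powr t + (1 - 1 / t) * s powr t))"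
      using assms by (intro sum_mono mult_left_mono young) auto
    also have "\<dots> = 1 / t * (\<Sum>i\<in>I. c i * a i powr t) + (1 - 1 / t) * s powr t * (\<Sum>i\<in>I. c i)"
      by (simp add: distrib_left sum.distrib sum_distrib_left sum_distrib_right mult_ac)
    also have "\<dots> \<le> 1 / t * (\<Sum>i\<in>I. c i * a i powr t) + (1 - 1 / t) * s powr t * 1"
      using assms by (intro add_left_mono mult_left_mono) auto
    finally have "1 / t * s powr t \<le> 1 / t * (\<Sum>i\<in>I. c i * a i powr t)"
      by (simp add: algebra_simps)
    then show ?thesis
      using assms by (simp add: s_def divide_le_cancel)
  qed
qed

text \<open>This takes the place of the triangle inequality and yields the same constant. Jensen
  with weights \<open>c k = (1 - q) * q ^ k\<close> is applied to the values
  \<open>h k / c k\<close>; the k-th term then contributes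
  \<open>c k * (1 / (1 - q)) powr t\<close>, and the \<open>c k\<close> sum to at most 1.\<close>

lemma geometric_series_powr_bound:
  fixes h :: "nat \<Rightarrow> 'a \<Rightarrow> real"
  assumes t: "1 \<le> t" and q: "0 < q" "q < 1"
    and h [measurable]: "\<And>k. h k \<in> borel_measurable M" and h0: "\<And>k x. x \<in> space M \<Longrightarrow> 0 \<le> h k x"
    and hq: "\<And>k. (\<integral>\<^sup>+ x. ennreal (h k x powr t) \<partial>M) \<le> ennreal ((q ^ k) powr t)"
  shows "AE x in M. summable (\<lambda>k. h k x)"
    and "(\<integral>\<^sup>+ x. ennreal ((\<Sum>k. h k x) powr t) \<partial>M) \<le> ennreal ((1 / (1 - q)) powr t)"
proof -
  define P where "P = (\<lambda>n x. \<Sum>k<n. h k x)"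
  have [measurable]: "P n \<in> borel_measurable M" for n unfolding P_def by measurable
  define B where "B = (1 / (1 - q)) powr t"
  define c where "c = (\<lambda>k. (1 - q) * q ^ k)"
  have c: "0 < c k" for k using q by (simp add: c_def)
  have sum_c: "(\<Sum>k<n. c k) \<le> 1" for n
    using q by (simp add: c_def sum_distrib_left[symmetric] sum_gp_strict)
  have Pn: "(\<integral>\<^sup>+ x. ennreal (P n x powr t) \<partial>M) \<le> ennreal B" for n
  proof -
    have "(\<integral>\<^sup>+ x. ennreal (P n x powr t) \<partial>M)
        \<le> (\<integral>\<^sup>+ x. (\<Sum>k<n. ennreal (c k * c k powr (- t)) * ennreal (h k x powr t)) \<partial>M)"
    proof (intro nn_integral_mono)
      fix x assume x: "x \<in> space M"
      have "P n x powr t = (\<Sum>k<n. c k * (h k x / c k)) powr t"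
        using c by (simp add: P_def less_imp_neq[symmetric])
      also have "\<dots> \<le> (\<Sum>k<n. c k * (h k x / c k) powr t)"
        using c h0[OF x] sum_c t by (intro Jensen_powr_sum) (auto simp: less_imp_le)
      also have "\<dots> = (\<Sum>k<n. c k * c k powr (- t) * h k x powr t)"
        using c h0[OF x] by (intro sum.cong) (auto simp: powr_divide powr_minus_divide less_imp_le)
      finally have "ennreal (P n x powr t) \<le> ennreal (\<Sum>k<n. c k * c k powr (- t) * h k x powr t)"
        by (rule ennreal_leI)
      also have "\<dots> = (\<Sum>k<n. ennreal (c k * c k powr (- t)) * ennreal (h k x powr t))"
        using c by (subst sum_ennreal[symmetric]) (auto simp: ennreal_mult' less_imp_le)
      finally show "ennreal (P n x powr t) \<le> (\<Sum>k<n. ennreal (c k * c k powr (- t)) * ennreal (h k x powr t))" .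
    qed
    also have "\<dots> = (\<Sum>k<n. ennreal (c k * c k powr (- t)) * (\<integral>\<^sup>+ x. ennreal (h k x powr t) \<partial>M))"
      by (subst nn_integral_sum) (auto simp: nn_integral_cmult)
    also have "\<dots> \<le> (\<Sum>k<n. ennreal (c k * c k powr (- t)) * ennreal ((q ^ k) powr t))"
      by (intro sum_mono mult_left_mono hq) simp
    also have "\<dots> = (\<Sum>k<n. ennreal (c k * B))"
    proof (intro sum.cong refl)
      fix k
      have "c k powr (- t) * (q ^ k) powr t = B"
        using q by (simp add: c_def B_def powr_mult powr_minus_divide powr_divide)
      then have "c k * c k powr (- t) * (q ^ k) powr t = c k * B"
        by (simp add: mult.assoc)
      then show "ennreal (c k * c k powr (- t)) * ennreal ((q ^ k) powr t) = ennreal (c k * B)"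
        by (simp only: ennreal_mult''[OF powr_ge_zero, symmetric])
    qed
    also have "\<dots> = ennreal ((\<Sum>k<n. c k) * B)"
      using c by (subst sum_ennreal) (auto simp: sum_distrib_right B_def less_imp_le)
    also have "\<dots> \<le> ennreal B"
      using mult_right_mono[OF sum_c, of B n] by (intro ennreal_leI) (simp add: B_def)
    finally show ?thesis .
  qed
  \<comment> \<open>By monotone convergence this supremum has a finite integral, so it is finite
    almost everywhere. The partial sums are then bounded at almost every point, which gives
    convergence of the series.\<close>
  define L where "L = (\<lambda>x. SUP n. ennreal (P n x powr t))"
  have "(\<integral>\<^sup>+ x. L x \<partial>M) = (SUP n. \<integral>\<^sup>+ x. ennreal (P n x powr t) \<partial>M)"
    unfolding L_def
  proof (rule nn_integral_monotone_convergence_SUP_AE)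
    fix i
    show "AE x in M. ennreal (P i x powr t) \<le> ennreal (P (Suc i) x powr t)"
      using h0 t by (intro AE_I2 ennreal_leI powr_mono2) (auto simp: P_def intro!: sum_nonneg)
  qed simp
  also have "\<dots> \<le> ennreal B" by (intro SUP_least Pn)
  finally have L: "(\<integral>\<^sup>+ x. L x \<partial>M) \<le> ennreal B" .
  have "AE x in M. L x \<noteq> \<infinity>"
    by (rule nn_integral_PInf_AE) (use L in \<open>auto simp: L_def top_unique\<close>)
  then have both: "AE x in M. summable (\<lambda>k. h k x) \<and> ennreal ((\<Sum>k. h k x) powr t) \<le> L x"
    using AE_space
  proof eventually_elim
    case (elim x)
    then obtain l where l: "L x = ennreal l" "0 \<le> l" by (cases "L x") auto
    have Pl: "P n x powr t \<le> l" for n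
    proof -
      have "ennreal (P n x powr t) \<le> L x"
        unfolding L_def by (intro SUP_upper) simp
      then show ?thesis using l by simp
    qed
    have P0: "0 \<le> P n x" for n
      using h0 elim by (auto simp: P_def intro: sum_nonneg)
    have "P n x \<le> l powr (1 / t)" for n
    proof -
      have "(P n x powr t) powr (1 / t) \<le> l powr (1 / t)"
        using Pl t by (intro powr_mono2) auto
      then show ?thesis using P0 t by (simp add: powr_powr)
    qed
    then have S: "summable (\<lambda>k. h k x)"
      using h0 elim by (intro summableI_nonneg_bounded) (auto simp: P_def)
    have "(\<Sum>k. h k x) \<le> l powr (1 / t)"
      using \<open>\<And>n. P n x \<le> l powr (1 / t)\<close> S by (intro suminf_le_const) (auto simp: P_def)
    then have "(\<Sum>k. h k x) powr t \<le> (l powr (1 / t)) powr t"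
      using S h0 elim t by (intro powr_mono2) (auto intro!: suminf_nonneg)
    then show ?case
      using S l t by (simp add: powr_powr ennreal_leI)
  qed
  then show "AE x in M. summable (\<lambda>k. h k x)"
    by (auto elim: eventually_mono)
  have "(\<integral>\<^sup>+ x. ennreal ((\<Sum>k. h k x) powr t) \<partial>M) \<le> (\<integral>\<^sup>+ x. L x \<partial>M)"
    using both by (intro nn_integral_mono_AE) (auto elim: eventually_mono)
  then show "(\<integral>\<^sup>+ x. ennreal ((\<Sum>k. h k x) powr t) \<partial>M) \<le> ennreal ((1 / (1 - q)) powr t)"
    using L by (simp add: B_def)
qed

section \<open>The iteration\<close>

text \<open>The last conclusion is a two-weight condition of A_1 type: on each basis set \<psi> is
  bounded below by a multiple of its average. The assumption \<open>nz\<close> lets the sum of the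
  iterates be positive almost everywhere, so that \<psi> is a weight.\<close>

lemma rubio_de_francia:
  assumes basis: "basis_of_sets M \<U>" and t: "1 \<le> t" and v: "weight M v" and w: "weight M w"
    and N: "maxop_norm M \<U> (ennreal t) v w \<le> ennreal N" "0 < N" and \<kappa>: "1 < \<kappa>"
    and F [measurable]: "F \<in> borel_measurable M" and F0: "\<And>x. 0 \<le> F x"
    and Fi: "(\<integral>\<^sup>+ x. ennreal (F x) \<partial>M) \<le> 1" and nz: "\<not> (AE x in M. F x = 0)"
  shows "\<exists>\<psi>. weight M \<psi> \<and> (AE x in M. F x \<le> (\<psi> x * v x) powr t)
    \<and> (\<integral>\<^sup>+ x. ennreal ((\<psi> x * v x) powr t) \<partial>M) \<le> ennreal (\<kappa> powr t)
    \<and> (\<forall>U\<in>\<U>. AE x in M. x \<in> U \<longrightarrow> ennreal (1 / measure M U) * (\<integral>\<^sup>+ y\<in>U. ennreal (\<psi> y) \<partial>M)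
          \<le> ennreal (\<kappa> / (\<kappa> - 1) * N * \<psi> x * v x / w x))"
proof -
  have [measurable]: "v \<in> borel_measurable M" "w \<in> borel_measurable M"
    using v w by (auto simp: weight_def)
  have v0: "0 < v x" and w0: "0 < w x" if "x \<in> space M" for x
    using that v w by (auto simp: weight_def)
  \<comment> \<open>Dividing by \<kappa>' times the operator norm makes each iterate smaller than
    the previous one by the ratio \<open>q = N / c = 1/\<kappa>'\<close>. The geometric series then
    has sum \<open>1 / (1 - q) = \<kappa>\<close>.\<close>
  define c where "c = \<kappa> / (\<kappa> - 1) * N"
  define q where "q = (\<kappa> - 1) / \<kappa>"
  have c: "0 < c" using \<kappa> N by (simp add: c_def)
  have q: "0 < q" "q < 1" "1 / (1 - q) = \<kappa>" "N / c = q"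
    using \<kappa> N by (auto simp: q_def c_def field_simps)
  \<comment> \<open>\<open>enn2real\<close> sends an infinite value to 0; \<open>fin\<close> shows
    below that this affects only a null set.\<close>
  define g where "g = rec_nat (\<lambda>x. F x powr (1 / t) / v x)
    (\<lambda>_ f x. enn2real (maxop M \<U> f x) * w x / (v x * c))"
  have g_0: "g 0 = (\<lambda>x. F x powr (1 / t) / v x)"
    and g_Suc: "g (Suc k) = (\<lambda>x. enn2real (maxop M \<U> (g k) x) * w x / (v x * c))" for k
    by (simp_all add: g_def)
  have g_meas [measurable]: "g k \<in> borel_measurable M" for k
  proof (induction k)
    case (Suc k)
    note maxop_measurable[OF basis Suc, measurable]
    show ?case unfolding g_Suc by measurable
  qed (simp add: g_0)
  have g_nonneg: "0 \<le> g k x" if "x \<in> space M" for k x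
    using v0[OF that] w0[OF that] c F0 by (cases k) (auto simp: g_0 g_Suc)
  have g_int: "(\<integral>\<^sup>+ x. ennreal ((g k x * v x) powr t) \<partial>M) \<le> ennreal ((q ^ k) powr t)" for k
  proof (induction k)
    case 0
    have "(\<integral>\<^sup>+ x. ennreal ((g 0 x * v x) powr t) \<partial>M) = (\<integral>\<^sup>+ x. ennreal (F x) \<partial>M)"
    proof (intro nn_integral_cong)
      fix x assume "x \<in> space M"
      then show "ennreal ((g 0 x * v x) powr t) = ennreal (F x)"
        using v0[of x] F0[of x] t by (simp add: g_0 powr_powr)
    qed
    then show ?case using Fi by simp
  next
    case (Suc k)
    have m [measurable]: "maxop M \<U> (g k) \<in> borel_measurable M"
      by (rule maxop_measurable[OF basis]) simp
    have "(\<integral>\<^sup>+ x. ennreal ((\<bar>g k x\<bar> * v x) powr t) \<partial>M) = (\<integral>\<^sup>+ x. ennreal ((g k x * v x) powr t) \<partial>M)"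
      using g_nonneg by (intro nn_integral_cong) simp
    with Suc have le: "(\<integral>\<^sup>+ x. ennreal ((enn2real (maxop M \<U> (g k) x) * w x) powr t) \<partial>M)
        \<le> ennreal ((q ^ k * N) powr t)"
      using t q N by (intro maxop_bound(2)[OF basis _ v w N(1)]) auto
    have "(\<integral>\<^sup>+ x. ennreal ((g (Suc k) x * v x) powr t) \<partial>M)
        = (\<integral>\<^sup>+ x. ennreal (c powr (- t)) * ennreal ((enn2real (maxop M \<U> (g k) x) * w x) powr t) \<partial>M)"
    proof (intro nn_integral_cong)
      fix x assume x: "x \<in> space M"
      have "g (Suc k) x * v x = enn2real (maxop M \<U> (g k) x) * w x / c"
        using v0[OF x] by (simp add: g_Suc)
      then show "ennreal ((g (Suc k) x * v x) powr t)
          = ennreal (c powr (- t)) * ennreal ((enn2real (maxop M \<U> (g k) x) * w x) powr t)"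
        using w0[OF x] c by (simp add: powr_divide powr_minus_divide ennreal_mult'[symmetric])
    qed
    also have "\<dots> = ennreal (c powr (- t)) * (\<integral>\<^sup>+ x. ennreal ((enn2real (maxop M \<U> (g k) x) * w x) powr t) \<partial>M)"
      by (intro nn_integral_cmult) simp
    also have "\<dots> \<le> ennreal (c powr (- t)) * ennreal ((q ^ k * N) powr t)"
      by (intro mult_left_mono le) simp
    also have "\<dots> = ennreal ((q ^ k * N / c) powr t)"
      using c q N by (simp add: powr_divide powr_minus_divide ennreal_mult'[symmetric])
    also have "q ^ k * N / c = q ^ Suc k"
      using q(4) by (metis power_Suc2 times_divide_eq_right)
    finally show ?case .
  qed
  have fin: "AE x in M. maxop M \<U> (g k) x < \<infinity>" for k
  proof (rule maxop_bound(1)[OF basis _ v w N(1), of "q ^ k"])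
    have "(\<integral>\<^sup>+ x. ennreal ((\<bar>g k x\<bar> * v x) powr t) \<partial>M) = (\<integral>\<^sup>+ x. ennreal ((g k x * v x) powr t) \<partial>M)"
      using g_nonneg by (intro nn_integral_cong) simp
    then show "(\<integral>\<^sup>+ x. ennreal ((\<bar>g k x\<bar> * v x) powr t) \<partial>M) \<le> ennreal ((q ^ k) powr t)"
      using g_int[of k] by simp
  qed (use t q N in auto)
  have fin': "AE x in M. \<forall>k. maxop M \<U> (g k) x < \<infinity>"
    unfolding AE_all_countable using fin by blast
  have h0: "0 \<le> g k x * v x" if "x \<in> space M" for k x
    using g_nonneg[OF that] v0[OF that] by simp
  have series: "AE x in M. summable (\<lambda>k. g k x * v x)"
    "(\<integral>\<^sup>+ x. ennreal ((\<Sum>k. g k x * v x) powr t) \<partial>M) \<le> ennreal ((1 / (1 - q)) powr t)"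
    using h0 g_int by (intro geometric_series_powr_bound[OF t q(1,2)]; simp)+
  have nz0: "\<not> (AE x in M. g 0 x = 0)"
  proof
    assume "AE x in M. g 0 x = 0"
    then have "AE x in M. F x = 0"
      using AE_space
    proof eventually_elim
      case (elim x)
      then show ?case using v0[of x] by (simp add: g_0)
    qed
    then show False using nz by simp
  qed
  \<comment> \<open>Where the series diverges its formal sum carries no information; the default
    value 1 keeps \<psi> positive everywhere.\<close>
  define \<psi> where "\<psi> = (\<lambda>x. if (\<Sum>k. g k x) > 0 then (\<Sum>k. g k x) else 1)"
  have \<psi>: "weight M \<psi>"
    unfolding weight_def \<psi>_def by auto
  have \<psi>_AE: "AE x in M. summable (\<lambda>k. g k x) \<and> \<psi> x = (\<Sum>k. g k x)"
    using series(1) fin' AE_space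
  proof eventually_elim
    case (elim x)
    have "summable (\<lambda>k. g k x)"
      using elim(1) summable_mult2[of "\<lambda>k. g k x * v x" "1 / v x"] v0[OF elim(3)] by simp
    \<comment> \<open>The initial function may vanish on a large set, but one application of the
      maximal operator makes it positive.\<close>
    moreover have "0 < g 1 x"
    proof -
      have "0 < enn2real (maxop M \<U> (g 0) x)"
        using maxop_pos[OF basis g_meas nz0 elim(3)] elim(2) by (auto simp: enn2real_positive_iff less_top)
      then show ?thesis
        using g_Suc[of 0] v0[OF elim(3)] w0[OF elim(3)] c by simp
    qed
    ultimately show ?case
      using suminf_pos2[of "\<lambda>k. g k x" 1] g_nonneg[OF elim(3)] by (simp add: \<psi>_def)
  qed
  have "AE x in M. F x \<le> (\<psi> x * v x) powr t"
    using \<psi>_AE AE_space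
  proof eventually_elim
    case (elim x)
    have "g 0 x \<le> \<psi> x"
      using sum_le_suminf[of "\<lambda>k. g k x" "{0}"] elim g_nonneg[OF elim(2)] by simp
    then have "(g 0 x * v x) powr t \<le> (\<psi> x * v x) powr t"
      using t v0[OF elim(2)] g_nonneg[OF elim(2)] by (intro powr_mono2 mult_right_mono) auto
    moreover have "(g 0 x * v x) powr t = F x"
      using t v0[OF elim(2)] F0[of x] by (simp add: g_0 powr_powr)
    ultimately show ?case by simp
  qed
  moreover have "(\<integral>\<^sup>+ x. ennreal ((\<psi> x * v x) powr t) \<partial>M) \<le> ennreal (\<kappa> powr t)"
  proof -
    have "AE x in M. ennreal ((\<psi> x * v x) powr t) = ennreal ((\<Sum>k. g k x * v x) powr t)"
      using \<psi>_AE by eventually_elim (simp add: suminf_mult2)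
    then have "(\<integral>\<^sup>+ x. ennreal ((\<psi> x * v x) powr t) \<partial>M)
        = (\<integral>\<^sup>+ x. ennreal ((\<Sum>k. g k x * v x) powr t) \<partial>M)"
      by (rule nn_integral_cong_AE)
    then show ?thesis
      using series(2) q(3) by simp
  qed
  moreover have "AE x in M. x \<in> U \<longrightarrow> ennreal (1 / measure M U) * (\<integral>\<^sup>+ y\<in>U. ennreal (\<psi> y) \<partial>M)
          \<le> ennreal (c * \<psi> x * v x / w x)" if U: "U \<in> \<U>" for U
    using \<psi>_AE fin' AE_space
  proof eventually_elim
    case (elim x)
    have [measurable]: "U \<in> sets M" using basis_measure_pos[OF basis U] by simp
    show ?case
    proof
      assume xU: "x \<in> U"
      let ?d = "c * v x / w x"
      \<comment> \<open>The average of \<open>g k\<close> over U is at most its maximal function at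
        x, which is \<open>g (Suc k) x * ?d\<close> by construction. Summation gives the series
        without its first term, hence at most \<open>\<psi> x * ?d\<close>.\<close>
      have S: "summable (\<lambda>k. g (Suc k) x)"
        using elim(1) summable_Suc_iff[of "\<lambda>k. g k x"] by simp
      have d: "0 \<le> ?d" using c v0[OF elim(3)] w0[OF elim(3)] by simp
      have "(\<integral>\<^sup>+ y\<in>U. ennreal (\<psi> y) \<partial>M) = (\<integral>\<^sup>+ y. (\<Sum>k. ennreal \<bar>g k y\<bar> * indicator U y) \<partial>M)"
      proof (rule nn_integral_cong_AE)
        show "AE y in M. ennreal (\<psi> y) * indicator U y = (\<Sum>k. ennreal \<bar>g k y\<bar> * indicator U y)"
          using \<psi>_AE AE_space
        proof eventually_elim
          case (elim y)
          then show ?case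
            using g_nonneg[of y] by (auto simp: suminf_ennreal2 split: split_indicator)
        qed
      qed
      also have "\<dots> = (\<Sum>k. \<integral>\<^sup>+ y\<in>U. ennreal \<bar>g k y\<bar> \<partial>M)"
        by (intro nn_integral_suminf) simp
      finally have "ennreal (1 / measure M U) * (\<integral>\<^sup>+ y\<in>U. ennreal (\<psi> y) \<partial>M)
          = (\<Sum>k. ennreal (1 / measure M U) * (\<integral>\<^sup>+ y\<in>U. ennreal \<bar>g k y\<bar> \<partial>M))"
        by simp
      also have "\<dots> \<le> (\<Sum>k. ennreal (g (Suc k) x * ?d))"
      proof (intro suminf_le)
        fix k
        have "maxop M \<U> (g k) x = ennreal (g (Suc k) x * ?d)"
          using elim(2) c v0[OF elim(3)] w0[OF elim(3)] by (simp add: g_Suc less_top)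
        then show "ennreal (1 / measure M U) * (\<integral>\<^sup>+ y\<in>U. ennreal \<bar>g k y\<bar> \<partial>M) \<le> ennreal (g (Suc k) x * ?d)"
          using average_le_maxop[OF U xU, of M "g k"] by simp
      qed auto
      also have "\<dots> = ennreal (\<Sum>k. g (Suc k) x * ?d)"
        using mult_nonneg_nonneg[OF g_nonneg[OF elim(3)] d] S
        by (intro suminf_ennreal2 summable_mult2) auto
      also have "(\<Sum>k. g (Suc k) x * ?d) = (\<Sum>k. g (Suc k) x) * ?d"
        using S by (rule suminf_mult2[symmetric])
      also have "(\<Sum>k. g (Suc k) x) = \<psi> x - g 0 x"
        using elim suminf_split_head[of "\<lambda>k. g k x"] by simp
      also have "ennreal ((\<psi> x - g 0 x) * ?d) \<le> ennreal (\<psi> x * ?d)"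
        using d g_nonneg[OF elim(3)] by (intro ennreal_leI mult_right_mono) auto
      finally show "ennreal (1 / measure M U) * (\<integral>\<^sup>+ y\<in>U. ennreal (\<psi> y) \<partial>M)
          \<le> ennreal (c * \<psi> x * v x / w x)"
        by (simp add: mult_ac)
    qed
  qed
  ultimately show ?thesis
    using \<psi> unfolding c_def by blast
qed

section \<open>Weight characteristics\<close>

text \<open>The characteristic in terms of reciprocal exponents, so that a shift of indices is an
  addition and infinite exponents need no separate treatment.\<close>

definition weight_char :: "'a measure \<Rightarrow> 'a set set \<Rightarrow> real \<Rightarrow> real \<Rightarrow> ('a \<Rightarrow> real) \<Rightarrow> ('a \<Rightarrow> real) \<Rightarrow> ennreal" where
  "weight_char M \<U> \<sigma> \<rho> w v = (SUP U\<in>\<U>. ennreal (measure M U powr (- \<sigma> - \<rho>))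
      * nrm M \<sigma> (\<lambda>x. indicator U x * w x) * nrm M \<rho> (\<lambda>x. indicator U x / v x))"

lemma charw_eq_weight_char:
  "s \<noteq> 0 \<Longrightarrow> r \<noteq> 0 \<Longrightarrow> charw M \<U> s r w v = weight_char M \<U> (rinv s) (rinv r) w v"
  by (simp add: charw_def weight_char_def Lpn_eq_nrm)

text \<open>The symmetry that reduces negative \<open>g\<close> to positive
  \<open>g\<close>.\<close>

lemma weight_char_swap:
  "weight_char M \<U> \<sigma> \<rho> w v = weight_char M \<U> \<rho> \<sigma> (\<lambda>x. 1 / v x) (\<lambda>x. 1 / w x)"
proof -
  have "- \<sigma> - \<rho> = - \<rho> - \<sigma>" by simp
  then show ?thesis
    unfolding weight_char_def by (intro SUP_cong) (simp_all only: mult_ac divide_divide_eq_right div_by_1 mult_1_right times_divide_eq_right mult_1_left)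
qed

lemma ex_in_set_of_pos_measure:
  assumes "AE x in M. x \<in> U \<longrightarrow> P x" "U \<in> sets M" "emeasure M U \<noteq> 0"
  shows "\<exists>x\<in>U. P x"
proof (rule ccontr)
  assume "\<not> ?thesis"
  then have "AE x in M. x \<notin> U"
    using assms(1) by (auto elim: eventually_mono)
  then have "U \<in> null_sets M"
    using assms(2) by (simp add: AE_iff_null_sets)
  then show False using assms by auto
qed

lemma nrm_indicator_pos:
  assumes "0 \<le> c" "weight M w" "U \<in> sets M" "emeasure M U \<noteq> 0"
  shows "nrm M c (\<lambda>x. indicator U x * w x) \<noteq> 0"
proof
  have [measurable]: "w \<in> borel_measurable M" "U \<in> sets M"
    using assms by (auto simp: weight_def)
  assume "nrm M c (\<lambda>x. indicator U x * w x) = 0"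
  then have "AE x in M. indicator U x * w x = 0"
    using assms by (subst (asm) nrm_eq_0_iff) auto
  then have "AE x in M. x \<notin> U"
    using AE_space
  proof eventually_elim
    case (elim x)
    then show ?case
      using assms(2) by (auto simp: weight_def split: split_indicator_asm)
  qed
  then show False
    using ex_in_set_of_pos_measure[where P = "\<lambda>_. False" and U = U and M = M] assms by auto
qed

lemma weight_recip: "weight M v \<Longrightarrow> weight M (\<lambda>x. 1 / v x)"
  by (auto simp: weight_def)

lemma weight_powr: "weight M v \<Longrightarrow> weight M (\<lambda>x. v x powr a)"
  by (auto simp: weight_def less_imp_neq[symmetric])

lemma weight_mult: "weight M v \<Longrightarrow> weight M w \<Longrightarrow> weight M (\<lambda>x. v x * w x)"
  by (auto simp: weight_def)

lemma weight_const: "0 < c \<Longrightarrow> weight M (\<lambda>x. c)"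
  by (auto simp: weight_def)

text \<open>Supplies a nonzero function with integral 1, both as a starting point of the iteration
  and as a test for the operator norm.\<close>

lemma normalized_indicator:
  assumes "basis_of_sets M \<U>" "U \<in> \<U>"
  shows "(\<integral>\<^sup>+ x. ennreal (indicator U x / measure M U) \<partial>M) = 1"
    and "\<not> (AE x in M. indicator U x / measure M U = (0::real))"
proof -
  note [measurable] = basis_measure_pos(1)[OF assms]
  have "(\<integral>\<^sup>+ x. ennreal (indicator U x / measure M U) \<partial>M)
      = (\<integral>\<^sup>+ x. ennreal (1 / measure M U) * indicator U x \<partial>M)"
    by (intro nn_integral_cong) (auto split: split_indicator)
  also have "\<dots> = ennreal (1 / measure M U) * ennreal (measure M U)"
    using basis_measure_pos[OF assms] by (simp add: nn_integral_cmult_indicator)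
  also have "\<dots> = 1"
    using basis_measure_pos[OF assms] by (simp add: ennreal_mult'[symmetric])
  finally show 1: "(\<integral>\<^sup>+ x. ennreal (indicator U x / measure M U) \<partial>M) = 1" .
  show "\<not> (AE x in M. indicator U x / measure M U = (0::real))"
  proof
    assume "AE x in M. indicator U x / measure M U = (0::real)"
    then have "(\<integral>\<^sup>+ x. ennreal (indicator U x / measure M U) \<partial>M) = (\<integral>\<^sup>+ x. 0 \<partial>M)"
      by (intro nn_integral_cong_AE) (auto elim: eventually_mono)
    then show False using 1 by simp
  qed
qed

text \<open>The iteration divides by the operator norm. If that norm were 0, the maximal function of
  a nonzero function would vanish almost everywhere, contrary to \<open>maxop_pos\<close>.\<close>

lemma maxop_norm_pos:
  assumes basis: "basis_of_sets M \<U>" and U: "U \<in> \<U>" and t: "0 < t" and v: "weight M v" and w: "weight M w"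
  shows "maxop_norm M \<U> (ennreal t) v w \<noteq> 0"
proof
  assume "maxop_norm M \<U> (ennreal t) v w = 0"
  then have N: "maxop_norm M \<U> (ennreal t) v w \<le> ennreal 0" by simp
  note [measurable] = basis_measure_pos(1)[OF basis U]
  have [measurable]: "v \<in> borel_measurable M" "w \<in> borel_measurable M"
    using v w by (auto simp: weight_def)
  have v0: "0 < v x" and w0: "0 < w x" if "x \<in> space M" for x
    using that v w by (auto simp: weight_def)
  define f where "f = (\<lambda>x. (indicator U x / measure M U) powr (1 / t) / v x)"
  have f [measurable]: "f \<in> borel_measurable M" unfolding f_def by measurable
  have m [measurable]: "maxop M \<U> f \<in> borel_measurable M"
    by (rule maxop_measurable[OF basis f])
  have "(\<integral>\<^sup>+ x. ennreal ((\<bar>f x\<bar> * v x) powr t) \<partial>M) = (\<integral>\<^sup>+ x. ennreal (indicator U x / measure M U) \<partial>M)"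
  proof (intro nn_integral_cong)
    fix x assume "x \<in> space M"
    then show "ennreal ((\<bar>f x\<bar> * v x) powr t) = ennreal (indicator U x / measure M U)"
      using v0[of x] t by (simp add: f_def powr_powr)
  qed
  also have "\<dots> \<le> ennreal (1 powr t)"
    using normalized_indicator(1)[OF basis U] by simp
  finally have le: "(\<integral>\<^sup>+ x. ennreal ((\<bar>f x\<bar> * v x) powr t) \<partial>M) \<le> ennreal (1 powr t)" .
  note mb = maxop_bound[OF basis t v w N order_refl zero_less_one f le]
  have "(\<integral>\<^sup>+ x. ennreal ((enn2real (maxop M \<U> f x) * w x) powr t) \<partial>M) = 0"
    using mb(2) by simp
  then have "AE x in M. ennreal ((enn2real (maxop M \<U> f x) * w x) powr t) = 0"
    by (subst (asm) nn_integral_0_iff_AE) auto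
  moreover have nz: "\<not> (AE x in M. f x = 0)"
  proof
    assume "AE x in M. f x = 0"
    then have "AE x in M. indicator U x / measure M U = (0::real)"
      using AE_space
    proof eventually_elim
      case (elim x)
      then show ?case using v0[of x] by (auto simp: f_def)
    qed
    then show False using normalized_indicator(2)[OF basis U] by simp
  qed
  ultimately have "AE x in M. x \<in> U \<longrightarrow> False"
    using mb(1) AE_space
  proof eventually_elim
    case (elim x)
    have "0 < enn2real (maxop M \<U> f x)"
      using maxop_pos[OF basis f nz elim(3)] elim(2) by (auto simp: enn2real_positive_iff less_top)
    then show ?case
      using elim w0[of x] by simp
  qed
  then show False
    using ex_in_set_of_pos_measure[where P = "\<lambda>_. False" and U = U and M = M] basis_measure_pos[OF basis U] by auto
qed

section \<open>Construction of the new pair of weights\<close>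

text \<open>With \<theta> the exponent of the old characteristic, the new weights compare with
  \<theta>-th powers of the old ones: \<open>v * G powr (- g)\<close> equals
  \<open>v powr \<theta>\<close> times a power of \<psi>, and on each basis set
  \<open>w * G powr (- g)\<close> is at most a constant times
  \<open>w powr \<theta>\<close>.\<close>

lemma extrapolation_weight_pos:
  assumes basis: "basis_of_sets M \<U>" and g: "0 < g" and \<sigma>0: "0 \<le> \<sigma>0" and \<rho>1: "0 \<le> \<rho>1"
    and a: "a = \<sigma>0 + g + \<rho>1" and t_eq: "t = a / (\<sigma>0 + g)"
    and w: "weight M w" and v: "weight M v"
    and char: "weight_char M \<U> (\<sigma>0 + g) \<rho>1 w v < \<infinity>"
    and N: "maxop_norm M \<U> (ennreal t) (\<lambda>x. v x powr (1 / a)) (\<lambda>x. w x powr (1 / a)) = ennreal N" "0 \<le> N"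
    and \<kappa>: "1 < \<kappa>"
    and F: "F \<in> borel_measurable M" and F0: "\<And>x. 0 \<le> F x"
    and Fi: "(\<integral>\<^sup>+ x. ennreal (F x) \<partial>M) \<le> 1"
  shows "\<exists>G. weight M G \<and> (AE x in M. F x \<le> G x) \<and> (\<integral>\<^sup>+ x. ennreal (G x) \<partial>M) \<le> ennreal (\<kappa> powr t)
    \<and> weight_char M \<U> \<sigma>0 (\<rho>1 + g) (\<lambda>x. w x * G x powr (- g)) (\<lambda>x. v x * G x powr (- g))
      \<le> ennreal ((\<kappa> / (\<kappa> - 1) * N) powr (t * g)
          * enn2real (weight_char M \<U> (\<sigma>0 + g) \<rho>1 w v) powr (\<sigma>0 / (\<sigma>0 + g)))"
proof (cases "\<U> = {}")
  case True
  then have "space M = {}" using basis by (simp add: basis_of_sets_def)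
  then have "(\<integral>\<^sup>+ x. ennreal 1 \<partial>M) = 0" "AE x in M. F x \<le> 1"
    by (auto intro!: nn_integral_empty AE_I2)
  then show ?thesis
    using True weight_const[of 1 M] by (intro exI[of _ "\<lambda>_. 1"]) (simp add: weight_char_def)
next
  case False
  then obtain U0 where U0: "U0 \<in> \<U>" by blast
  define \<sigma>1 where "\<sigma>1 = \<sigma>0 + g"
  \<comment> \<open>This is t/t0 in the notation of the theorem. The identity
    \<open>t * g = a * (1 - \<theta>)\<close> derived from it makes the powers of the measure of U
    match at the end.\<close>
  define \<theta> where "\<theta> = \<sigma>0 / \<sigma>1"
  have \<sigma>1: "0 < \<sigma>1" using g \<sigma>0 by (simp add: \<sigma>1_def)
  have a0: "0 < a" using g \<sigma>0 \<rho>1 by (simp add: a)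
  have t: "1 \<le> t" using \<sigma>1 \<rho>1 g \<sigma>0 by (simp add: t_eq a \<sigma>1_def)
  have \<theta>: "0 \<le> \<theta>" using \<sigma>1 \<sigma>0 by (simp add: \<theta>_def)
  have g_eq: "g = \<sigma>1 * (1 - \<theta>)" and \<sigma>0_eq: "\<sigma>0 = \<theta> * \<sigma>1"
    using \<sigma>1 by (auto simp: \<theta>_def \<sigma>1_def right_diff_distrib)
  have tg: "t * g = a * (1 - \<theta>)" and tg_a: "t * g / a = 1 - \<theta>"
    using \<sigma>1 a0 by (simp_all add: t_eq \<sigma>1_def[symmetric]) (simp_all add: g_eq)
  have tg0: "0 < t * g" using t g by simp
  have \<rho>0_eq: "\<theta> * \<rho>1 + t * g = \<rho>1 + g"
    using g_eq unfolding tg a \<sigma>1_def[symmetric] by (simp add: algebra_simps)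
  define wt where "wt = (\<lambda>x. w x powr (1 / a))"
  define vt where "vt = (\<lambda>x. v x powr (1 / a))"
  have wt: "weight M wt" and vt: "weight M vt"
    unfolding wt_def vt_def using w v by (auto intro: weight_powr)
  have Nle: "maxop_norm M \<U> (ennreal t) vt wt \<le> ennreal N"
    using N by (simp add: wt_def vt_def)
  have N0: "0 < N"
    using N maxop_norm_pos[OF basis U0 _ vt wt, of t] t by (cases "N = 0") (auto simp: wt_def vt_def)
  have v0: "0 < v x" and w0: "0 < w x" if "x \<in> space M" for x
    using that v w by (auto simp: weight_def)
  \<comment> \<open>The iteration needs a nonzero start; if F vanishes almost everywhere, a
    normalised indicator dominates it and takes its place.\<close>
  have "\<exists>F'. F' \<in> borel_measurable M \<and> (\<forall>x. 0 \<le> F' x) \<and> (\<integral>\<^sup>+ x. ennreal (F' x) \<partial>M) \<le> 1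
      \<and> \<not> (AE x in M. F' x = 0) \<and> (AE x in M. F x \<le> F' x)"
  proof (cases "AE x in M. F x = 0")
    case True
    have "AE x in M. F x \<le> indicator U0 x / measure M U0"
      using True by eventually_elim simp
    then show ?thesis
      using normalized_indicator[OF basis U0] basis_measure_pos[OF basis U0]
      by (intro exI[of _ "\<lambda>x. indicator U0 x / measure M U0"]) auto
  next
    case False
    then show ?thesis using F F0 Fi by (intro exI[of _ F]) auto
  qed
  then obtain F' where F': "F' \<in> borel_measurable M" "\<And>x. 0 \<le> F' x" "(\<integral>\<^sup>+ x. ennreal (F' x) \<partial>M) \<le> 1"
      "\<not> (AE x in M. F' x = 0)" "AE x in M. F x \<le> F' x"
    by blast
  obtain \<psi> where \<psi>: "weight M \<psi>" "AE x in M. F' x \<le> (\<psi> x * vt x) powr t"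
     "(\<integral>\<^sup>+ x. ennreal ((\<psi> x * vt x) powr t) \<partial>M) \<le> ennreal (\<kappa> powr t)"
     "\<And>U. U \<in> \<U> \<Longrightarrow> AE x in M. x \<in> U \<longrightarrow> ennreal (1 / measure M U) * (\<integral>\<^sup>+ y\<in>U. ennreal (\<psi> y) \<partial>M)
          \<le> ennreal (\<kappa> / (\<kappa> - 1) * N * \<psi> x * vt x / wt x)"
    using rubio_de_francia[OF basis t vt wt Nle N0 \<kappa> F'(1-4)] by blast
  have \<psi>0: "0 < \<psi> x" if "x \<in> space M" for x
    using that \<psi>(1) by (auto simp: weight_def)
  define G where "G = (\<lambda>x. (\<psi> x * vt x) powr t)"
  have G: "weight M G"
    unfolding G_def by (intro weight_powr weight_mult \<psi> vt)
  have Gg: "G x powr (- g) = \<psi> x powr (- (t * g)) * v x powr (- (1 - \<theta>))" if "x \<in> space M" for x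
  proof -
    have "G x powr (- g) = (\<psi> x * vt x) powr (- (t * g))"
      by (simp add: G_def powr_powr)
    also have "\<dots> = \<psi> x powr (- (t * g)) * v x powr (- (t * g / a))"
      using \<psi>0[OF that] by (simp add: powr_mult vt_def powr_powr)
    finally show ?thesis by (simp only: tg_a)
  qed
  define D where "D = \<kappa> / (\<kappa> - 1) * N"
  have D: "0 < D" using \<kappa> N0 by (simp add: D_def)
  let ?W1 = "weight_char M \<U> \<sigma>1 \<rho>1 w v"
  obtain C where C: "?W1 = ennreal C" "0 \<le> C"
    using char unfolding \<sigma>1_def by (cases "weight_char M \<U> (\<sigma>0 + g) \<rho>1 w v") auto
  have [measurable]: "w \<in> borel_measurable M" "v \<in> borel_measurable M" "\<psi> \<in> borel_measurable M"
    using w v \<psi> by (auto simp: weight_def)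
  have "weight_char M \<U> \<sigma>0 (\<rho>1 + g) (\<lambda>x. w x * G x powr (- g)) (\<lambda>x. v x * G x powr (- g))
      \<le> ennreal (D powr (t * g) * C powr \<theta>)"
    unfolding weight_char_def
  proof (rule SUP_least)
    fix U assume U: "U \<in> \<U>"
    define e where "e = measure M U"
    have e: "0 < e" "emeasure M U = ennreal e" and Us [measurable]: "U \<in> sets M"
      using basis_measure_pos[OF basis U] by (auto simp: e_def)
    have Usp: "x \<in> space M" if "x \<in> U" for x
      using that sets.sets_into_space[OF Us] by blast
    let ?Aw = "nrm M \<sigma>1 (\<lambda>x. indicator U x * w x)" and ?Av = "nrm M \<rho>1 (\<lambda>x. indicator U x / v x)"
    have term_le: "ennreal (e powr (- \<sigma>1 - \<rho>1)) * ?Aw * ?Av \<le> ennreal C"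
      using SUP_upper[OF U, of "\<lambda>U. ennreal (measure M U powr (- \<sigma>1 - \<rho>1))
      * nrm M \<sigma>1 (\<lambda>x. indicator U x * w x) * nrm M \<rho>1 (\<lambda>x. indicator U x / v x)"] C
      by (simp add: weight_char_def e_def)
    \<comment> \<open>The characteristic bounds only the product of the two norms. As neither is 0,
      each of them is finite.\<close>
    have "?Aw \<noteq> 0"
      using nrm_indicator_pos[OF _ w Us] \<sigma>1 e by simp
    moreover have "?Av \<noteq> 0"
      using nrm_indicator_pos[OF \<rho>1 weight_recip[OF v] Us] e by simp
    moreover have "?Aw \<noteq> \<infinity>" "?Av \<noteq> \<infinity>"
      using term_le calculation e by (auto simp: ennreal_top_mult ennreal_mult_top top_unique)
    ultimately obtain Aw Av where A: "?Aw = ennreal Aw" "0 < Aw" "?Av = ennreal Av" "0 < Av"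
      by (metis ennreal_cases ennreal_0 infinity_ennreal_def less_le)
    have C_ge: "e powr (- a) * Aw * Av \<le> C"
    proof -
      have "- \<sigma>1 - \<rho>1 = - a" by (simp add: a \<sigma>1_def)
      then show ?thesis
        using term_le A C by (simp add: ennreal_mult'[symmetric])
    qed
    let ?I = "\<integral>\<^sup>+ y\<in>U. ennreal (\<psi> y) \<partial>M"
    \<comment> \<open>A single point of U at which the average bound holds already makes the
      integral of \<psi> over U finite.\<close>
    obtain x0 where "ennreal (1 / e) * ?I \<le> ennreal (\<kappa> / (\<kappa> - 1) * N * \<psi> x0 * vt x0 / wt x0)"
      using ex_in_set_of_pos_measure[OF \<psi>(4)[OF U] Us] e by (auto simp: e_def)
    then have "?I \<noteq> \<infinity>"
      using e by (auto simp: ennreal_mult_top top_unique)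
    moreover have "?I \<noteq> 0"
    proof
      assume "?I = 0"
      then have "AE y in M. ennreal (\<psi> y) * indicator U y = 0"
        by (subst (asm) nn_integral_0_iff_AE) auto
      then have "AE y in M. y \<in> U \<longrightarrow> False"
      proof eventually_elim
        case (elim y)
        then show ?case using \<psi>0[OF Usp, of y] by (auto split: split_indicator_asm)
      qed
      then show False
        using ex_in_set_of_pos_measure[where P = "\<lambda>_. False" and U = U and M = M] e by auto
    qed
    ultimately obtain I where I: "?I = ennreal I" "0 < I"
      by (metis ennreal_cases ennreal_0 infinity_ennreal_def less_le)
    \<comment> \<open>The reciprocal of \<open>v * G powr (- g)\<close> is
      \<open>v powr (- \<theta>) * \<psi> powr (t * g)\<close>, and Hoelder for these two factors
      lands at index \<open>\<theta> * \<rho>1 + t * g = \<rho>1 + g\<close>.\<close>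
    have "nrm M (\<theta> * \<rho>1) (\<lambda>x. \<bar>indicator U x / v x\<bar> powr \<theta>) \<le> ennreal (Av powr \<theta>)"
      using A \<rho>1 \<theta> by (intro nrm_powr_le) auto
    then have "nrm M (\<theta> * \<rho>1 + t * g) (\<lambda>x. \<bar>indicator U x / v x\<bar> powr \<theta> * (indicator U x * \<psi> x) powr (t * g))
        \<le> ennreal (Av powr \<theta> * I powr (t * g))"
    proof (rule Holder_nrm[rotated 7])
      show "(\<integral>\<^sup>+ x. ennreal (indicator U x * \<psi> x) \<partial>M) \<le> ennreal I"
        unfolding I(1)[symmetric] by (intro nn_integral_mono) (auto split: split_indicator)
      show "0 \<le> indicator U x * \<psi> x" if "x \<in> space M" for x
        using \<psi>0[OF that] by simp
    qed (use \<theta> \<rho>1 tg0 I in auto)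
    also have "nrm M (\<theta> * \<rho>1 + t * g) (\<lambda>x. \<bar>indicator U x / v x\<bar> powr \<theta> * (indicator U x * \<psi> x) powr (t * g))
        = nrm M (\<rho>1 + g) (\<lambda>x. indicator U x / (v x * G x powr (- g)))"
      unfolding \<rho>0_eq
    proof (rule nrm_cong_AE)
      show "AE x in M. \<bar>\<bar>indicator U x / v x\<bar> powr \<theta> * (indicator U x * \<psi> x) powr (t * g)\<bar>
          = \<bar>indicator U x / (v x * G x powr (- g))\<bar>"
      proof (intro AE_I2)
        fix x assume x: "x \<in> space M"
        have "v x * v x powr (- (1 - \<theta>)) = v x powr 1 * v x powr (- (1 - \<theta>))"
          using v0[OF x] by simp
        also have "\<dots> = v x powr \<theta>"
          by (subst powr_add[symmetric]) simp
        finally have "v x * G x powr (- g) = v x powr \<theta> * \<psi> x powr (- (t * g))"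
          using Gg[OF x] by (simp add: mult_ac)
        then show "\<bar>\<bar>indicator U x / v x\<bar> powr \<theta> * (indicator U x * \<psi> x) powr (t * g)\<bar>
          = \<bar>indicator U x / (v x * G x powr (- g))\<bar>"
          using v0[OF x] \<psi>0[OF x] tg0
          by (auto simp: powr_divide powr_minus_divide split: split_indicator)
      qed
    qed (use \<rho>1 g in auto)
    finally have Bv: "nrm M (\<rho>1 + g) (\<lambda>x. indicator U x / (v x * G x powr (- g))) \<le> ennreal (Av powr \<theta> * I powr (t * g))" .
    \<comment> \<open>On U the lower bound for \<psi> reads
      \<open>wt / vt / \<psi> \<le> D * e / I\<close>. Raised to the power \<open>t * g\<close>, its
      left side becomes \<open>w powr (1 - \<theta>) * G powr (- g)\<close>, so multiplication by
      \<open>w powr \<theta>\<close> gives the bound with constant \<open>k\<close>.\<close>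
    define k where "k = (D * e / I) powr (t * g)"
    have k: "0 < k" using D e I by (simp add: k_def)
    have "nrm M \<sigma>0 (\<lambda>x. indicator U x * (w x * G x powr (- g)))
        \<le> nrm M \<sigma>0 (\<lambda>x. k * \<bar>indicator U x * w x\<bar> powr \<theta>)"
    proof (rule nrm_mono_AE[OF \<sigma>0])
      show "AE x in M. \<bar>indicator U x * (w x * G x powr (- g))\<bar> \<le> \<bar>k * \<bar>indicator U x * w x\<bar> powr \<theta>\<bar>"
        using \<psi>(4)[OF U] AE_space
      proof eventually_elim
        case (elim x)
        show ?case
        proof (cases "x \<in> U")
          case True
          note pos = v0[OF elim(2)] w0[OF elim(2)] \<psi>0[OF elim(2)]
          have pos': "0 < vt x" "0 < wt x" using pos by (auto simp: vt_def wt_def)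
          have "ennreal (I / e) \<le> ennreal (D * \<psi> x * vt x / wt x)"
            using elim True I e by (simp add: D_def e_def[symmetric] ennreal_mult'[symmetric])
          then have "I / e \<le> D * \<psi> x * vt x / wt x"
            using pos pos' D by (subst (asm) ennreal_le_iff) auto
          then have "wt x / vt x / \<psi> x \<le> D * e / I"
            using pos pos' D I e by (simp add: field_simps)
          then have "(wt x / vt x / \<psi> x) powr (t * g) \<le> k"
            unfolding k_def using pos pos' tg0 by (intro powr_mono2) auto
          moreover have "(wt x / vt x / \<psi> x) powr (t * g) = w x powr (1 - \<theta>) * G x powr (- g)"
          proof -
            have "(wt x / vt x / \<psi> x) powr (t * g)
                = w x powr (t * g / a) / v x powr (t * g / a) / \<psi> x powr (t * g)"
              by (simp add: powr_divide powr_mult wt_def vt_def powr_powr)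
            then show ?thesis
              unfolding tg_a by (subst Gg[OF elim(2)]) (simp add: powr_minus_divide[of _ "1 - \<theta>"] powr_minus_divide[of _ "t * g"] del: minus_diff_eq)
          qed
          ultimately have "w x powr (1 - \<theta>) * G x powr (- g) \<le> k" by simp
          then have "w x powr \<theta> * (w x powr (1 - \<theta>) * G x powr (- g)) \<le> w x powr \<theta> * k"
            by (intro mult_left_mono) auto
          moreover have "w x powr \<theta> * w x powr (1 - \<theta>) = w x"
            using pos by (simp flip: powr_add)
          ultimately have "w x * G x powr (- g) \<le> k * w x powr \<theta>"
            by (metis mult.assoc mult.commute)
          then show ?thesis
            using True pos k by simp
        qed simp
      qed
    qed
    also have "\<dots> \<le> ennreal (k * Aw powr \<theta>)"
    proof (rule nrm_cmult_le[OF \<sigma>0 k])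
      show "nrm M \<sigma>0 (\<lambda>x. \<bar>indicator U x * w x\<bar> powr \<theta>) \<le> ennreal (Aw powr \<theta>)"
        unfolding \<sigma>0_eq using A \<sigma>1 \<theta> by (intro nrm_powr_le) auto
    qed auto
    finally have Bw: "nrm M \<sigma>0 (\<lambda>x. indicator U x * (w x * G x powr (- g))) \<le> ennreal (k * Aw powr \<theta>)" .
    have exps: "- \<sigma>0 - (\<rho>1 + g) = - a" by (simp add: a)
    have "ennreal (measure M U powr (- \<sigma>0 - (\<rho>1 + g))) * nrm M \<sigma>0 (\<lambda>x. indicator U x * (w x * G x powr (- g)))
        * nrm M (\<rho>1 + g) (\<lambda>x. indicator U x / (v x * G x powr (- g)))
      \<le> ennreal (e powr (- a)) * ennreal (k * Aw powr \<theta>) * ennreal (Av powr \<theta> * I powr (t * g))"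
      unfolding exps e_def[symmetric] by (intro mult_mono Bw Bv order_refl) auto
    also have "\<dots> = ennreal (e powr (- a) * (k * Aw powr \<theta>) * (Av powr \<theta> * I powr (t * g)))"
      using k A I by (simp add: ennreal_mult'[symmetric])
    \<comment> \<open>The power of \<open>I\<close> in \<open>k\<close> cancels the one from
      Hoelder, and \<open>- a + t * g = - a * \<theta>\<close> collects the rest into the
      \<theta>-th power of one term of the old characteristic.\<close>
    also have "e powr (- a) * (k * Aw powr \<theta>) * (Av powr \<theta> * I powr (t * g))
        = D powr (t * g) * (e powr (- a) * Aw * Av) powr \<theta>"
    proof -
      have "e powr (- a) * e powr (t * g) = e powr (- a * \<theta>)"
        unfolding tg by (simp add: algebra_simps flip: powr_add)
      moreover have "k * I powr (t * g) = D powr (t * g) * e powr (t * g)"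
        using D e I by (simp add: k_def powr_mult powr_divide)
      ultimately have "e powr (- a) * (k * I powr (t * g)) = D powr (t * g) * e powr (- a * \<theta>)"
        by (simp add: mult_ac)
      moreover have "(e powr (- a) * Aw * Av) powr \<theta> = e powr (- a * \<theta>) * Aw powr \<theta> * Av powr \<theta>"
        using e A by (simp add: powr_mult powr_powr)
      ultimately show ?thesis by (simp add: mult_ac)
    qed
    also have "ennreal \<dots> \<le> ennreal (D powr (t * g) * C powr \<theta>)"
      using C_ge \<theta> e A D by (intro ennreal_leI mult_left_mono powr_mono2) auto
    finally show "ennreal (measure M U powr (- \<sigma>0 - (\<rho>1 + g))) * nrm M \<sigma>0 (\<lambda>x. indicator U x * (w x * G x powr (- g)))
        * nrm M (\<rho>1 + g) (\<lambda>x. indicator U x / (v x * G x powr (- g)))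
      \<le> ennreal (D powr (t * g) * C powr \<theta>)" .
  qed
  moreover have "AE x in M. F x \<le> G x"
    using F'(5) \<psi>(2) by eventually_elim (simp add: G_def)
  moreover have "(\<integral>\<^sup>+ x. ennreal (G x) \<partial>M) \<le> ennreal (\<kappa> powr t)"
    using \<psi>(3) by (simp add: G_def)
  ultimately show ?thesis
    using G C by (intro exI[of _ G]) (simp add: D_def \<theta>_def \<sigma>1_def)
qed

section \<open>Extrapolation\<close>

lemma extrapolation_weight:
  assumes basis: "basis_of_sets M \<U>" and g: "g \<noteq> 0"
    and nz: "s0 \<noteq> 0" "s1 \<noteq> 0" "r0 \<noteq> 0" "r1 \<noteq> 0"
    and s: "rinv s1 - rinv s0 = g" and r: "rinv r0 - rinv r1 = g"
    and w: "weight M w" and v: "weight M v" and char: "charw M \<U> s1 r1 w v < \<infinity>"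
    and N: "maxop_norm M \<U> (tpar g s0 r0 s1 r1) (vtpar g s0 r0 w v) (wtpar g s0 r0 w v) = ennreal N" "0 \<le> N"
    and \<kappa>: "1 < \<kappa>" and F: "F \<in> borel_measurable M" "\<And>x. 0 \<le> F x" "(\<integral>\<^sup>+ x. ennreal (F x) \<partial>M) \<le> 1"
  shows "\<exists>G. weight M G \<and> (AE x in M. F x \<le> G x)
    \<and> (\<integral>\<^sup>+ x. ennreal (G x) \<partial>M) \<le> ennreal (\<kappa> powr enn2real (tpar g s0 r0 s1 r1))
    \<and> charw M \<U> s0 r0 (\<lambda>x. w x * G x powr (- g)) (\<lambda>x. v x * G x powr (- g))
      \<le> ennreal ((\<kappa> / (\<kappa> - 1) * N) powr (enn2real (tpar g s0 r0 s1 r1) * \<bar>g\<bar>)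
          * enn2real (charw M \<U> s1 r1 w v) powr (enn2real (tpar g s0 r0 s1 r1) * rinv (t0par g s0 r0)))"
proof -
  define a where "a = ainv s0 r0"
  define t where "t = enn2real (tpar g s0 r0 s1 r1)"
  have inv1: "inverse (ennreal (x / a)) = ennreal (a / x)" if "0 < x" "0 < a" for x
    using that by (simp add: inverse_ennreal)
  \<comment> \<open>The value \<open>y = 0\<close> belongs to the rescaled exponent
    infinity.\<close>
  have inv2: "rinv (inverse (ennreal (y / a))) = y / a" if "0 < a" "0 \<le> y" for y
    using that by (simp_all add: inverse_ennreal rinv_def) (cases "y = 0"; simp add: inverse_ennreal)
  show ?thesis
  proof (cases "0 < g")
    case True
    have a: "a = rinv s0 + g + rinv r1" and s1: "rinv s1 = rinv s0 + g" and r0: "rinv r0 = rinv r1 + g"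
      using s r by (auto simp: a_def ainv_def)
    have pos: "0 < a" "0 < rinv s1"
      using True rinv_nonneg[of s0] rinv_nonneg[of r1] s1 unfolding a by linarith+
    have tpar: "tpar g s0 r0 s1 r1 = ennreal (a / rinv s1)"
      using True inv1 pos by (simp add: tpar_def a_def)
    then have t: "t = a / (rinv s0 + g)" and tt: "tpar g s0 r0 s1 r1 = ennreal t"
      using pos s1 by (simp_all add: t_def)
    have t0: "rinv (t0par g s0 r0) = rinv s0 / a"
      using True inv2[of "rinv s0"] pos by (simp add: t0par_def a_def)
    have \<theta>: "t * rinv (t0par g s0 r0) = rinv s0 / (rinv s0 + g)"
      unfolding t t0 using pos by simp
    have ch: "weight_char M \<U> (rinv s0 + g) (rinv r1) w v = charw M \<U> s1 r1 w v"
      using nz by (simp add: charw_eq_weight_char s1)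
    have N': "maxop_norm M \<U> (ennreal t) (\<lambda>x. v x powr (1 / a)) (\<lambda>x. w x powr (1 / a)) = ennreal N"
      using N True by (simp add: tt vtpar_def wtpar_def a_def)
    show ?thesis
      using extrapolation_weight_pos[OF basis True rinv_nonneg rinv_nonneg a t w v _ N' N(2) \<kappa> F]
      unfolding ch t_def[symmetric] \<theta> using char True nz by (simp add: charw_eq_weight_char r0)
  next
    case False
    then have g': "0 < - g" using g by simp
    have a: "a = rinv r0 + - g + rinv s1" and r1: "rinv r1 = rinv r0 + - g" and s0: "rinv s0 = rinv s1 + - g"
      using s r by (auto simp: a_def ainv_def)
    have pos: "0 < a" "0 < rinv r1"
      using g' rinv_nonneg[of r0] rinv_nonneg[of s1] r1 unfolding a by linarith+
    have tpar: "tpar g s0 r0 s1 r1 = ennreal (a / rinv r1)"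
      using g' inv1 pos by (simp add: tpar_def a_def)
    then have t: "t = a / (rinv r0 + - g)" and tt: "tpar g s0 r0 s1 r1 = ennreal t"
      using pos r1 by (simp_all add: t_def)
    have t0: "rinv (t0par g s0 r0) = rinv r0 / a"
      using g' inv2[of "rinv r0"] pos by (simp add: t0par_def a_def)
    have \<theta>: "t * rinv (t0par g s0 r0) = rinv r0 / (rinv r0 + - g)"
      unfolding t t0 using pos by simp
    have ch: "weight_char M \<U> (rinv r0 + - g) (rinv s1) (\<lambda>x. 1 / v x) (\<lambda>x. 1 / w x) = charw M \<U> s1 r1 w v"
      using nz r1 weight_char_swap[of M \<U> "rinv s1" "rinv r1" w v] by (simp add: charw_eq_weight_char)
    have N': "maxop_norm M \<U> (ennreal t) (\<lambda>x. (1 / w x) powr (1 / a)) (\<lambda>x. (1 / v x) powr (1 / a)) = ennreal N"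
      using N g' by (simp add: tt vtpar_def wtpar_def a_def powr_divide powr_minus_divide)
    \<comment> \<open>The swapped pair consists of the reciprocals of
      \<open>v * G powr (- g)\<close> and \<open>w * G powr (- g)\<close>, so the \<open>G\<close>
      found for index \<open>- g\<close> serves unchanged.\<close>
    have ch0: "weight_char M \<U> (rinv r0) (rinv s1 + - g) (\<lambda>x. 1 / v x * G x powr (- (- g))) (\<lambda>x. 1 / w x * G x powr (- (- g)))
        = charw M \<U> s0 r0 (\<lambda>x. w x * G x powr (- g)) (\<lambda>x. v x * G x powr (- g))" for G
      using nz s0 weight_char_swap[of M \<U> "rinv s0" "rinv r0"]
      by (simp add: charw_eq_weight_char powr_minus_divide)
    have abs: "\<bar>g\<bar> = - g" using g' by simp
    show ?thesis
      using extrapolation_weight_pos[OF basis g' rinv_nonneg rinv_nonneg a t weight_recip[OF v] weight_recip[OF w] _ N' N(2) \<kappa> F]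
      unfolding ch ch0 t_def[symmetric] \<theta> abs using char by blast
  qed
qed

section \<open>A single component\<close>

text \<open>For \<open>g < 0\<close> the function F is prescribed from outside and the norm of f
  pays a power of \<kappa> through Hoelder. For \<open>g > 0\<close> the dominated function is built
  from f itself, and the norm of f passes to the new exponent without loss.\<close>

lemma extrapolation_step:
  assumes basis: "basis_of_sets M \<U>"
    and nz: "p0 \<noteq> 0" "p1 \<noteq> 0" "s0 \<noteq> 0" "s1 \<noteq> 0" "r0 \<noteq> 0" "r1 \<noteq> 0"
    and p: "rinv p1 - rinv p0 = g" and s: "rinv s1 - rinv s0 = g" and r: "rinv r0 - rinv r1 = g"
    and w: "weight M w" and v: "weight M v" and char: "charw M \<U> s1 r1 w v < \<infinity>"
    and bdd: "g \<noteq> 0 \<Longrightarrow> maxop_norm M \<U> (tpar g s0 r0 s1 r1) (vtpar g s0 r0 w v) (wtpar g s0 r0 w v) < \<infinity>"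
    and \<kappa>: "1 < \<kappa>" and F: "F \<in> borel_measurable M" "\<And>x. 0 \<le> F x" "(\<integral>\<^sup>+ x. ennreal (F x) \<partial>M) \<le> 1"
    and f: "f \<in> Lpw_space M p1 v"
  shows "\<exists>G. weight M G \<and> (g < 0 \<longrightarrow> (AE x in M. F x \<le> G x))
    \<and> (g \<noteq> 0 \<longrightarrow> (\<integral>\<^sup>+ x. ennreal (G x) \<partial>M) \<le> ennreal (\<kappa> powr enn2real (tpar g s0 r0 s1 r1)))
    \<and> (\<lambda>x. w x * G x powr (- g), \<lambda>x. v x * G x powr (- g)) \<in> Wset M \<U> g s0 r0 w v
    \<and> enn2real (charw M \<U> s0 r0 (\<lambda>x. w x * G x powr (- g)) (\<lambda>x. v x * G x powr (- g)))
      \<le> (if g = 0 then 1 else (\<kappa> / (\<kappa> - 1) * enn2real (maxop_norm M \<U> (tpar g s0 r0 s1 r1)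
              (vtpar g s0 r0 w v) (wtpar g s0 r0 w v))) powr (enn2real (tpar g s0 r0 s1 r1) * \<bar>g\<bar>))
          * enn2real (charw M \<U> s1 r1 w v) powr (enn2real (tpar g s0 r0 s1 r1) * rinv (t0par g s0 r0))
    \<and> Lpw M p0 (\<lambda>x. v x * G x powr (- g)) f
      \<le> ennreal ((if g < 0 then \<kappa> powr (enn2real (tpar g s0 r0 s1 r1) * \<bar>g\<bar>) else 1) * enn2real (Lpw M p1 v f))"
proof (cases "g = 0")
  case True
  \<comment> \<open>Here all indices agree and \<open>G = 1\<close> suffices; \<open>tpar\<close>
    and \<open>t0par\<close> are 1, so the characteristic enters with exponent 1.\<close>
  have "charw M \<U> s0 r0 w v = charw M \<U> s1 r1 w v" "Lpw M p0 v f = Lpw M p1 v f"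
    using True nz p s r by (simp_all add: charw_eq_weight_char Lpw_def Lpn_eq_nrm)
  moreover have "Lpw M p1 v f < \<infinity>" using f by (simp add: Lpw_space_def)
  ultimately show ?thesis
    using True weight_const[of 1 M]
    by (intro exI[of _ "\<lambda>_. 1"]) (simp add: Wset_def tpar_def t0par_def rinv_def)
next
  case False
  let ?t = "enn2real (tpar g s0 r0 s1 r1)"
  obtain N where N: "maxop_norm M \<U> (tpar g s0 r0 s1 r1) (vtpar g s0 r0 w v) (wtpar g s0 r0 w v) = ennreal N" "0 \<le> N"
    using bdd[OF False] by (cases "maxop_norm M \<U> (tpar g s0 r0 s1 r1) (vtpar g s0 r0 w v) (wtpar g s0 r0 w v)") auto
  have [measurable]: "f \<in> borel_measurable M" "v \<in> borel_measurable M"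
    using f v by (auto simp: Lpw_space_def weight_def)
  obtain A where A: "Lpw M p1 v f = ennreal A" "0 \<le> A"
    using f by (cases "Lpw M p1 v f") (auto simp: Lpw_space_def)
  have nA: "nrm M (rinv p1) (\<lambda>x. f x * v x) = ennreal A"
    using A nz by (simp add: Lpw_def Lpn_eq_nrm)
  \<comment> \<open>Normalised to norm at most 1; for \<open>A = 0\<close> the convention
    \<open>1 / 0 = 0\<close> makes it identically 0.\<close>
  define \<Phi> where "\<Phi> = (\<lambda>x. 1 / A * (f x * v x))"
  have \<Phi> [measurable]: "\<Phi> \<in> borel_measurable M" unfolding \<Phi>_def by measurable
  have n\<Phi>: "nrm M (rinv p1) \<Phi> \<le> ennreal 1" if "A \<noteq> 0"
    using nrm_cmult_le[of "rinv p1" "1 / A" A M "\<lambda>x. f x * v x"] that A nA by (simp add: \<Phi>_def)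
  have \<Phi>_0: "\<Phi> = (\<lambda>x. 0)" if "A = 0"
    using that by (simp add: \<Phi>_def)
  \<comment> \<open>For \<open>g > 0\<close> the index \<open>rinv p1\<close> is positive, so p1 is
    finite and the p1-th power of \<Phi> has integral at most 1.\<close>
  define F' where "F' = (if g < 0 then F else (\<lambda>x. \<bar>\<Phi> x\<bar> powr (1 / rinv p1)))"
  have p1: "0 < rinv p1" if "0 < g"
    using that p rinv_nonneg[of p0] by linarith
  have F': "F' \<in> borel_measurable M" "\<And>x. 0 \<le> F' x" "(\<integral>\<^sup>+ x. ennreal (F' x) \<partial>M) \<le> 1"
  proof -
    show "F' \<in> borel_measurable M" "\<And>x. 0 \<le> F' x" using F by (simp_all add: F'_def)
    show "(\<integral>\<^sup>+ x. ennreal (F' x) \<partial>M) \<le> 1"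
    proof (cases "g < 0 \<or> A = 0")
      case True
      then show ?thesis using F \<Phi>_0 by (auto simp: F'_def)
    next
      case f: False
      then have "(\<integral>\<^sup>+ x. ennreal (\<bar>\<Phi> x\<bar> powr (1 / rinv p1)) \<partial>M) \<le> ennreal (1 powr (1 / rinv p1))"
        using p1 n\<Phi> False by (subst nrm_pos_le_iff[symmetric]) auto
      then show ?thesis using f by (simp add: F'_def)
    qed
  qed
  obtain G where G: "weight M G" "AE x in M. F' x \<le> G x"
    "(\<integral>\<^sup>+ x. ennreal (G x) \<partial>M) \<le> ennreal (\<kappa> powr ?t)"
    "charw M \<U> s0 r0 (\<lambda>x. w x * G x powr (- g)) (\<lambda>x. v x * G x powr (- g))
      \<le> ennreal ((\<kappa> / (\<kappa> - 1) * N) powr (?t * \<bar>g\<bar>) * enn2real (charw M \<U> s1 r1 w v) powr (?t * rinv (t0par g s0 r0)))"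
    using extrapolation_weight[OF basis False nz(3-6) s r w v char N \<kappa> F'] by blast
  have G0: "0 < G x" if "x \<in> space M" for x using G that by (simp add: weight_def)
  have [measurable]: "G \<in> borel_measurable M" using G by (simp add: weight_def)
  have char0: "charw M \<U> s0 r0 (\<lambda>x. w x * G x powr (- g)) (\<lambda>x. v x * G x powr (- g)) < \<infinity>"
    using G(4) by (simp add: order_le_less_trans)
  have "(\<lambda>x. w x * G x powr (- g), \<lambda>x. v x * G x powr (- g)) \<in> Wset M \<U> g s0 r0 w v"
    using False char0 G0 by (force simp: Wset_def intro!: weight_mult weight_powr w v G)
  moreover have "enn2real (charw M \<U> s0 r0 (\<lambda>x. w x * G x powr (- g)) (\<lambda>x. v x * G x powr (- g)))
      \<le> (\<kappa> / (\<kappa> - 1) * N) powr (?t * \<bar>g\<bar>) * enn2real (charw M \<U> s1 r1 w v) powr (?t * rinv (t0par g s0 r0))"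
    using enn2real_mono[OF G(4)] by simp
  moreover have "Lpw M p0 (\<lambda>x. v x * G x powr (- g)) f
      \<le> ennreal ((if g < 0 then \<kappa> powr (?t * \<bar>g\<bar>) else 1) * A)"
  proof (cases "g < 0")
    case True
    have "nrm M (rinv p1 + - g) (\<lambda>x. f x * v x * G x powr (- g)) \<le> ennreal (A * (\<kappa> powr ?t) powr (- g))"
      using True G A \<kappa> nA G0 by (intro Holder_nrm) (auto simp: less_imp_le)
    moreover have "rinv p1 + - g = rinv p0" using p by simp
    ultimately show ?thesis
      using True nz by (simp add: Lpw_def Lpn_eq_nrm powr_powr mult_ac)
  next
    case gp: False
    then have g0: "0 < g" using False by simp
    have "nrm M (rinv p0) (\<lambda>x. f x * (v x * G x powr (- g))) \<le> ennreal A"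
    proof (cases "A = 0")
      case True
      then have "AE x in M. f x * v x = 0"
        using nA nrm_eq_0_iff[of "rinv p1" "\<lambda>x. f x * v x" M] by simp
      then have "AE x in M. f x * (v x * G x powr (- g)) = 0"
        by eventually_elim auto
      then have "nrm M (rinv p0) (\<lambda>x. f x * (v x * G x powr (- g))) = 0"
        by (subst nrm_eq_0_iff) auto
      then show ?thesis by simp
    next
      case A0: False
      then have Apos: "0 < A" using A by simp
      \<comment> \<open>From \<open>F' \<le> G\<close> it follows that \<open>G powr (- g)\<close>
        is at most \<Phi> to the power \<open>- g / rinv p1\<close>. Hence the product with \<Phi>
        is at most \<Phi> to the power \<theta> = p1/p0, whose norm at index \<open>rinv p0\<close>
        is again at most 1.\<close>
      define \<theta> where "\<theta> = rinv p0 / rinv p1"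
      have \<theta>: "0 \<le> \<theta>" "rinv p0 = \<theta> * rinv p1" "1 - g / rinv p1 = \<theta>"
        using p1[OF g0] p by (auto simp: \<theta>_def field_simps)
      have "nrm M (rinv p0) (\<lambda>x. f x * (v x * G x powr (- g))) \<le> nrm M (rinv p0) (\<lambda>x. A * \<bar>\<Phi> x\<bar> powr \<theta>)"
      proof (rule nrm_mono_AE[OF rinv_nonneg])
        show "AE x in M. \<bar>f x * (v x * G x powr (- g))\<bar> \<le> \<bar>A * \<bar>\<Phi> x\<bar> powr \<theta>\<bar>"
          using G(2)
        proof eventually_elim
          case (elim x)
          have fv: "f x * v x = A * \<Phi> x" using Apos by (simp add: \<Phi>_def)
          have "\<bar>\<Phi> x\<bar> * G x powr (- g) \<le> \<bar>\<Phi> x\<bar> powr \<theta>"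
          proof (cases "\<Phi> x = 0")
            case False
            then have "0 < F' x" using gp by (simp add: F'_def)
            then have "G x powr (- g) \<le> F' x powr (- g)"
              using elim g0 by (intro powr_mono2') auto
            also have "\<dots> = \<bar>\<Phi> x\<bar> powr (- (g / rinv p1))"
              using gp by (simp add: F'_def powr_powr)
            finally have "\<bar>\<Phi> x\<bar> * G x powr (- g) \<le> \<bar>\<Phi> x\<bar> powr 1 * \<bar>\<Phi> x\<bar> powr (- (g / rinv p1))"
              by (simp add: mult_left_mono)
            also have "\<dots> = \<bar>\<Phi> x\<bar> powr (1 + - (g / rinv p1))"
              by (rule powr_add[symmetric])
            also have "1 + - (g / rinv p1) = \<theta>" using \<theta> by simp
            finally show ?thesis .
          qed simp
          then have "A * (\<bar>\<Phi> x\<bar> * G x powr (- g)) \<le> A * \<bar>\<Phi> x\<bar> powr \<theta>"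
            using Apos by (intro mult_left_mono) auto
          moreover have "\<bar>f x * (v x * G x powr (- g))\<bar> = A * (\<bar>\<Phi> x\<bar> * G x powr (- g))"
          proof -
            have "f x * (v x * G x powr (- g)) = A * (\<Phi> x * G x powr (- g))"
              by (metis fv mult.assoc)
            then have "\<bar>f x * (v x * G x powr (- g))\<bar> = \<bar>A * (\<Phi> x * G x powr (- g))\<bar>"
              by (rule arg_cong)
            also have "\<dots> = A * (\<bar>\<Phi> x\<bar> * G x powr (- g))"
              using Apos by (simp add: abs_mult)
            finally show ?thesis .
          qed
          ultimately show ?case using Apos by simp
        qed
      qed
      also have "\<dots> \<le> ennreal (A * 1)"
      proof (rule nrm_cmult_le[OF rinv_nonneg Apos])
        show "nrm M (rinv p0) (\<lambda>x. \<bar>\<Phi> x\<bar> powr \<theta>) \<le> ennreal 1"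
          using nrm_powr_le[OF rinv_nonneg \<theta>(1) zero_less_one n\<Phi>[OF A0]] by (simp add: \<theta>(2))
      qed auto
      finally show ?thesis by simp
    qed
    then show ?thesis
      using gp nz by (simp add: Lpw_def Lpn_eq_nrm)
  qed
  moreover have "g < 0 \<longrightarrow> (AE x in M. F x \<le> G x)" using G(2) by (auto simp: F'_def)
  ultimately show ?thesis
    using False G(1,3) N A by (intro exI[of _ G]) simp
qed

section \<open>Combining the components\<close>

lemma Holder_nrm_prod:
  assumes "finite I" "\<And>i. i \<in> I \<Longrightarrow> 0 < g i" "\<And>i. i \<in> I \<Longrightarrow> weight M (G i)" "\<And>i. i \<in> I \<Longrightarrow> 0 < B i"
    "\<And>i. i \<in> I \<Longrightarrow> (\<integral>\<^sup>+ x. ennreal (G i x) \<partial>M) \<le> ennreal (B i)"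
    and c: "0 \<le> c" and X: "0 \<le> X" and h: "h \<in> borel_measurable M" and nh: "nrm M c h \<le> ennreal X"
  shows "nrm M (c + (\<Sum>i\<in>I. g i)) (\<lambda>x. h x * (\<Prod>i\<in>I. G i x powr g i))
      \<le> ennreal (X * (\<Prod>i\<in>I. B i powr g i))"
  using assms(1-5)
proof (induction I rule: finite_induct)
  case empty
  then show ?case using nh by simp
next
  case (insert i I)
  have Gm: "G j \<in> borel_measurable M" if "j \<in> insert i I" for j
    using insert.prems(2)[OF that] by (simp add: weight_def)
  have "nrm M (c + (\<Sum>i\<in>I. g i) + g i) (\<lambda>x. h x * (\<Prod>i\<in>I. G i x powr g i) * G i x powr g i)
      \<le> ennreal (X * (\<Prod>i\<in>I. B i powr g i) * B i powr g i)"
  proof (rule Holder_nrm)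
    show "0 \<le> c + sum g I" using c insert.prems(1) by (intro add_nonneg_nonneg sum_nonneg) (auto simp: less_imp_le)
    show "(\<lambda>x. h x * (\<Prod>i\<in>I. G i x powr g i)) \<in> borel_measurable M"
      using h Gm by (intro borel_measurable_times borel_measurable_prod powr_real_measurable) auto
    show "0 \<le> G i x" if "x \<in> space M" for x
      using insert.prems(2)[of i] that by (auto simp: weight_def less_imp_le)
  qed (use insert X Gm in \<open>auto intro!: mult_nonneg_nonneg prod_nonneg\<close>)
  then show ?case
    using insert.hyps by (simp add: mult_ac add_ac)
qed

theorem theorem2p6:
  fixes M :: "'a measure" and \<U> :: "'a set set" and m :: nat
    and q0 q1 :: ennreal and p0 p1 s0 s1 r0 r1 :: "nat \<Rightarrow> ennreal"
    and g :: "nat \<Rightarrow> real"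
    and w1 v1 :: "nat \<Rightarrow> 'a \<Rightarrow> real"
    and V :: "nat \<Rightarrow> 'b set" and S :: "nat \<Rightarrow> 'b \<Rightarrow> 'a \<Rightarrow> real"
    and T :: "(nat \<Rightarrow> 'b) \<Rightarrow> 'a \<Rightarrow> real"
    and \<phi> :: "(nat \<Rightarrow> real) \<Rightarrow> real"
  defines "t0 \<equiv> (\<lambda>j. t0par (g j) (s0 j) (r0 j))"
      and "t1 \<equiv> (\<lambda>j. tpar (g j) (s0 j) (r0 j) (s1 j) (r1 j))"
      and "wt \<equiv> (\<lambda>j. wtpar (g j) (s0 j) (r0 j) (w1 j) (v1 j))"
      and "vt \<equiv> (\<lambda>j. vtpar (g j) (s0 j) (r0 j) (w1 j) (v1 j))"
      and "W \<equiv> (\<lambda>j. Wset M \<U> (g j) (s0 j) (r0 j) (w1 j) (v1 j))"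
      and "D \<equiv> PiE {..<m} (\<lambda>j. \<Union>(w0, v0)\<in>Wset M \<U> (g j) (s0 j) (r0 j) (w1 j) (v1 j). {f \<in> V j. S j f \<in> Lpw_space M (p0 j) v0})"
  assumes sf: "sigma_finite_measure M"
    and basis: "basis_of_sets M \<U>"
    and exps: "q0 \<noteq> 0" "q1 \<noteq> 0"
      "\<forall>j<m. p0 j \<noteq> 0 \<and> p1 j \<noteq> 0 \<and> s0 j \<noteq> 0 \<and> s1 j \<noteq> 0 \<and> r0 j \<noteq> 0 \<and> r1 j \<noteq> 0"
    and gam: "\<forall>j<m. rinv (p1 j) - rinv (p0 j) = g j \<and> rinv (s1 j) - rinv (s0 j) = g j
                    \<and> rinv (r0 j) - rinv (r1 j) = g j"
    and gamq: "rinv q1 - rinv q0 = (\<Sum>j<m. g j)"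
    and wts: "\<forall>j<m. weight M (w1 j) \<and> weight M (v1 j)
                    \<and> charw M \<U> (s1 j) (r1 j) (w1 j) (v1 j) < \<infinity>"
    and bdd: "\<forall>j<m. g j \<noteq> 0 \<longrightarrow> maxop_norm M \<U> (t1 j) (vt j) (wt j) < \<infinity>"
    and SL0: "\<forall>j<m. \<forall>x\<in>V j. S j x \<in> borel_measurable M"
    and TL0: "\<forall>f\<in>D. T f \<in> borel_measurable M"
    and phi_mono: "\<forall>x y. (\<forall>j<m. x j \<le> y j) \<longrightarrow> \<phi> x \<le> \<phi> y"
    and hyp: "\<forall>W0. (\<forall>j<m. W0 j \<in> W j) \<longrightarrow>
       (\<forall>f\<in>PiE {..<m} (\<lambda>j. {h \<in> V j. S j h \<in> Lpw_space M (p0 j) (snd (W0 j))}).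
          enn2ereal (Lpw M q0 (\<lambda>x. \<Prod>j<m. fst (W0 j) x) (T f))
            \<le> ereal (\<phi> (\<lambda>j. enn2real (charw M \<U> (s0 j) (r0 j) (fst (W0 j)) (snd (W0 j))))
                 * (\<Prod>j<m. enn2real (Lpw M (p0 j) (snd (W0 j)) (S j (f j))))))"
  shows "PiE {..<m} (\<lambda>j. {h \<in> V j. S j h \<in> Lpw_space M (p1 j) (v1 j)}) \<subseteq> D
    \<and> (\<forall>\<kappa>::real. 1 < \<kappa> \<longrightarrow>
        (\<forall>f\<in>PiE {..<m} (\<lambda>j. {h \<in> V j. S j h \<in> Lpw_space M (p1 j) (v1 j)}).
          enn2ereal (Lpw M q1 (\<lambda>x. \<Prod>j<m. w1 j x) (T f))
            \<le> ereal (\<kappa> powr (\<Sum>j<m. enn2real (t1 j) * \<bar>g j\<bar>)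
                 * \<phi> (\<lambda>j. (if g j = 0 then 1
                        else (\<kappa> / (\<kappa> - 1) * enn2real (maxop_norm M \<U> (t1 j) (vt j) (wt j)))
                               powr (enn2real (t1 j) * \<bar>g j\<bar>))
                      * enn2real (charw M \<U> (s1 j) (r1 j) (w1 j) (v1 j))
                          powr (enn2real (t1 j) * rinv (t0 j)))
                 * (\<Prod>j<m. enn2real (Lpw M (p1 j) (v1 j) (S j (f j)))))))"
proof (intro conjI subsetI allI impI ballI)
  let ?in1 = "PiE {..<m} (\<lambda>j. {h \<in> V j. S j h \<in> Lpw_space M (p1 j) (v1 j)})"
  define Nm where "Nm = (\<lambda>j. enn2real (maxop_norm M \<U> (t1 j) (vt j) (wt j)))"
  define C where "C = (\<lambda>\<kappa> j. (if g j = 0 then 1 else (\<kappa> / (\<kappa> - 1) * Nm j) powr (enn2real (t1 j) * \<bar>g j\<bar>))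
      * enn2real (charw M \<U> (s1 j) (r1 j) (w1 j) (v1 j)) powr (enn2real (t1 j) * rinv (t0 j)))"
  \<comment> \<open>The part of the cost that is paid on the side of S f; components with
    \<open>g j > 0\<close> pay on the side of T f instead.\<close>
  define K where "K = (\<lambda>\<kappa> j. if g j < 0 then \<kappa> powr (enn2real (t1 j) * \<bar>g j\<bar>) else 1)"
  have step: "\<exists>G. \<forall>j<m. weight M (G j) \<and> (g j < 0 \<longrightarrow> (AE x in M. F x \<le> G j x))
      \<and> (g j \<noteq> 0 \<longrightarrow> (\<integral>\<^sup>+ x. ennreal (G j x) \<partial>M) \<le> ennreal (\<kappa> powr enn2real (t1 j)))
      \<and> (\<lambda>x. w1 j x * G j x powr (- g j), \<lambda>x. v1 j x * G j x powr (- g j)) \<in> W j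
      \<and> enn2real (charw M \<U> (s0 j) (r0 j) (\<lambda>x. w1 j x * G j x powr (- g j)) (\<lambda>x. v1 j x * G j x powr (- g j))) \<le> C \<kappa> j
      \<and> Lpw M (p0 j) (\<lambda>x. v1 j x * G j x powr (- g j)) (S j (f j))
        \<le> ennreal (K \<kappa> j * enn2real (Lpw M (p1 j) (v1 j) (S j (f j))))"
    if prems: "1 < \<kappa>" "f \<in> ?in1" "F \<in> borel_measurable M" "\<And>x. 0 \<le> F x" "(\<integral>\<^sup>+ x. ennreal (F x) \<partial>M) \<le> 1"
    for \<kappa> f F
  proof -
    have "\<exists>G. weight M G \<and> (g j < 0 \<longrightarrow> (AE x in M. F x \<le> G x))
      \<and> (g j \<noteq> 0 \<longrightarrow> (\<integral>\<^sup>+ x. ennreal (G x) \<partial>M) \<le> ennreal (\<kappa> powr enn2real (t1 j)))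
      \<and> (\<lambda>x. w1 j x * G x powr (- g j), \<lambda>x. v1 j x * G x powr (- g j)) \<in> W j
      \<and> enn2real (charw M \<U> (s0 j) (r0 j) (\<lambda>x. w1 j x * G x powr (- g j)) (\<lambda>x. v1 j x * G x powr (- g j))) \<le> C \<kappa> j
      \<and> Lpw M (p0 j) (\<lambda>x. v1 j x * G x powr (- g j)) (S j (f j))
        \<le> ennreal (K \<kappa> j * enn2real (Lpw M (p1 j) (v1 j) (S j (f j))))" if j: "j < m" for j
    proof -
      have Sf: "S j (f j) \<in> Lpw_space M (p1 j) (v1 j)"
        using prems(2) j by (auto simp: PiE_def Pi_def)
      show ?thesis
        unfolding C_def K_def Nm_def t0_def t1_def wt_def vt_def W_def
        using exps gam wts bdd j Sf
        by (intro extrapolation_step basis prems) (auto simp: t1_def vt_def wt_def)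
    qed
    then show ?thesis by meson
  qed
  show inD: "f \<in> D" if f: "f \<in> ?in1" for f
  proof -
    \<comment> \<open>The domain requires just one admissible pair per component; \<kappa> = 2 and F
      = 0 are arbitrary choices.\<close>
    obtain G where G: "\<And>j. j < m \<Longrightarrow> (\<lambda>x. w1 j x * G j x powr (- g j), \<lambda>x. v1 j x * G j x powr (- g j)) \<in> W j"
      "\<And>j. j < m \<Longrightarrow> Lpw M (p0 j) (\<lambda>x. v1 j x * G j x powr (- g j)) (S j (f j))
        \<le> ennreal (K 2 j * enn2real (Lpw M (p1 j) (v1 j) (S j (f j))))"
      using step[of 2 f "\<lambda>_. 0"] f by auto
    have "f j \<in> (\<Union>(w0, v0)\<in>W j. {f \<in> V j. S j f \<in> Lpw_space M (p0 j) v0})" if j: "j < m" for j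
    proof -
      have "f j \<in> V j" using f j by (auto simp: PiE_def Pi_def)
      moreover have "S j (f j) \<in> Lpw_space M (p0 j) (\<lambda>x. v1 j x * G j x powr (- g j))"
        using G(2)[OF j] SL0 j \<open>f j \<in> V j\<close> by (auto simp: Lpw_space_def order_le_less_trans)
      ultimately show ?thesis using G(1)[OF j] by blast
    qed
    then show ?thesis
      using f unfolding D_def W_def by (auto simp: PiE_def Pi_def)
  qed
  fix \<kappa> :: real and f assume \<kappa>: "1 < \<kappa>" and f: "f \<in> ?in1"
  define A where "A = (\<lambda>j. enn2real (Lpw M (p1 j) (v1 j) (S j (f j))))"
  \<comment> \<open>The weights found below depend on F, but this bound does not; duality requires
    exactly that.\<close>
  define X where "X = \<phi> (C \<kappa>) * (\<Prod>j<m. K \<kappa> j * A j)"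
  have Tm [measurable]: "T f \<in> borel_measurable M" using TL0 inD[OF f] by blast
  have w1m [measurable]: "w1 j \<in> borel_measurable M" if "j < m" for j
    using wts that by (auto simp: weight_def)
  have fV: "f j \<in> V j" "S j (f j) \<in> borel_measurable M" if "j < m" for j
    using f SL0 that by (auto simp: PiE_def Pi_def)
  have Kpos: "0 < K \<kappa> j" for j using \<kappa> by (simp add: K_def)
  have main: "\<exists>G. (\<forall>j<m. weight M (G j) \<and> (g j < 0 \<longrightarrow> (AE x in M. F x \<le> G j x))
      \<and> (g j \<noteq> 0 \<longrightarrow> (\<integral>\<^sup>+ x. ennreal (G j x) \<partial>M) \<le> ennreal (\<kappa> powr enn2real (t1 j)))) \<and> 0 \<le> X
      \<and> nrm M (rinv q0) (\<lambda>x. T f x * (\<Prod>j<m. w1 j x * G j x powr (- g j))) \<le> ennreal X"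
    if F: "F \<in> borel_measurable M" "\<And>x. 0 \<le> F x" "(\<integral>\<^sup>+ x. ennreal (F x) \<partial>M) \<le> 1" for F
  proof -
    obtain G where G: "\<And>j. j < m \<Longrightarrow> weight M (G j)" "\<And>j. j < m \<Longrightarrow> g j < 0 \<longrightarrow> (AE x in M. F x \<le> G j x)"
      "\<And>j. j < m \<Longrightarrow> g j \<noteq> 0 \<longrightarrow> (\<integral>\<^sup>+ x. ennreal (G j x) \<partial>M) \<le> ennreal (\<kappa> powr enn2real (t1 j))"
      "\<And>j. j < m \<Longrightarrow> (\<lambda>x. w1 j x * G j x powr (- g j), \<lambda>x. v1 j x * G j x powr (- g j)) \<in> W j"
      "\<And>j. j < m \<Longrightarrow> enn2real (charw M \<U> (s0 j) (r0 j) (\<lambda>x. w1 j x * G j x powr (- g j)) (\<lambda>x. v1 j x * G j x powr (- g j))) \<le> C \<kappa> j"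
      "\<And>j. j < m \<Longrightarrow> Lpw M (p0 j) (\<lambda>x. v1 j x * G j x powr (- g j)) (S j (f j)) \<le> ennreal (K \<kappa> j * A j)"
      using step[OF \<kappa> f F] unfolding A_def by blast
    define W0 where "W0 = (\<lambda>j. (\<lambda>x. w1 j x * G j x powr (- g j), \<lambda>x. v1 j x * G j x powr (- g j)))"
    define B where "B = (\<lambda>j. enn2real (Lpw M (p0 j) (snd (W0 j)) (S j (f j))))"
    define ch where "ch = (\<lambda>j. enn2real (charw M \<U> (s0 j) (r0 j) (fst (W0 j)) (snd (W0 j))))"
    have B_le: "0 \<le> B j" "B j \<le> K \<kappa> j * A j" if "j < m" for j
    proof -
      show "0 \<le> B j" by (simp add: B_def)
      have "0 \<le> K \<kappa> j * A j" using Kpos[of j] by (simp add: A_def)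
      then show "B j \<le> K \<kappa> j * A j"
        using enn2real_mono[OF G(6)[OF that]] by (simp add: B_def W0_def)
    qed
    have v0: "weight M (snd (W0 j))" if "j < m" for j
      using wts that by (auto simp: W0_def intro!: weight_mult weight_powr G)
    have W0: "\<forall>j<m. W0 j \<in> W j" using G(4) by (simp add: W0_def)
    have "f \<in> PiE {..<m} (\<lambda>j. {h \<in> V j. S j h \<in> Lpw_space M (p0 j) (snd (W0 j))})"
    proof (rule PiE_I)
      fix j assume "j \<in> {..<m}"
      then have j: "j < m" by simp
      show "f j \<in> {h \<in> V j. S j h \<in> Lpw_space M (p0 j) (snd (W0 j))}"
        using G(6)[OF j] fV[OF j] by (auto simp: Lpw_space_def W0_def order_le_less_trans)
    next
      fix j assume "j \<notin> {..<m}"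
      then show "f j = undefined" using f by (rule PiE_arb[rotated])
    qed
    then have h: "enn2ereal (Lpw M q0 (\<lambda>x. \<Prod>j<m. fst (W0 j) x) (T f)) \<le> ereal (\<phi> ch * (\<Prod>j<m. B j))"
      using hyp W0 unfolding ch_def B_def by blast
    have "0 \<le> ereal (\<phi> ch * (\<Prod>j<m. B j))"
      using order_trans[OF enn2ereal_nonneg h] .
    then have nonneg: "0 \<le> \<phi> ch * (\<Prod>j<m. B j)" by simp
    have \<phi>_le: "\<phi> ch \<le> \<phi> (C \<kappa>)"
      using phi_mono G(5) by (simp add: ch_def W0_def)
    \<comment> \<open>\<phi> may be negative, so monotonicity cannot be multiplied through at once.
      If every \<open>B j\<close> is positive, the hypothesis forces
      \<open>\<phi> ch \<ge> 0\<close>. If some \<open>B j\<close> is 0, then S f vanishes almost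
      everywhere in that component, and both products are 0.\<close>
    have "\<phi> ch * (\<Prod>j<m. B j) \<le> X"
    proof (cases "\<exists>j<m. B j = 0")
      case True
      then obtain j where j: "j < m" "B j = 0" by blast
      have [measurable]: "S j (f j) \<in> borel_measurable M" "snd (W0 j) \<in> borel_measurable M" "v1 j \<in> borel_measurable M"
        using fV[OF j(1)] v0[OF j(1)] wts j by (auto simp: weight_def)
      have p: "p0 j \<noteq> 0" "p1 j \<noteq> 0" using exps j by auto
      have "Lpw M (p0 j) (snd (W0 j)) (S j (f j)) \<noteq> \<infinity>"
        using G(6)[OF j(1)] by (auto simp: W0_def top_unique)
      then have "Lpw M (p0 j) (snd (W0 j)) (S j (f j)) = 0"
        using j(2) by (auto simp: B_def enn2real_eq_0_iff)
      then have "AE x in M. S j (f j) x * snd (W0 j) x = 0"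
        using p nrm_eq_0_iff[of "rinv (p0 j)" "\<lambda>x. S j (f j) x * snd (W0 j) x" M]
        by (simp add: Lpw_def Lpn_eq_nrm)
      then have "AE x in M. S j (f j) x * v1 j x = 0"
        using AE_space
      proof eventually_elim
        case (elim x)
        then show ?case using v0[OF j(1)] by (auto simp: weight_def)
      qed
      then have "Lpw M (p1 j) (v1 j) (S j (f j)) = 0"
        using p nrm_eq_0_iff[of "rinv (p1 j)" "\<lambda>x. S j (f j) x * v1 j x" M]
        by (simp add: Lpw_def Lpn_eq_nrm)
      then have z1: "(\<Prod>j<m. K \<kappa> j * A j) = 0"
        using j(1) by (intro prod_zero) (auto simp: A_def intro!: bexI[of _ j])
      have z2: "(\<Prod>j<m. B j) = 0"
        using j by (intro prod_zero) auto
      show ?thesis unfolding X_def z1 z2 by simp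
    next
      case False
      then have "0 < (\<Prod>j<m. B j)"
        using B_le by (intro prod_pos) (auto simp: less_le)
      then have "0 \<le> \<phi> ch" using nonneg by (simp add: zero_le_mult_iff)
      then show ?thesis
        unfolding X_def using \<phi>_le B_le by (intro mult_mono prod_mono prod_nonneg) auto
    qed
    then have X: "0 \<le> X" "enn2ereal (Lpw M q0 (\<lambda>x. \<Prod>j<m. fst (W0 j) x) (T f)) \<le> ereal X"
      using nonneg h order_trans by (auto intro: order_trans[OF h])
    then have "Lpw M q0 (\<lambda>x. \<Prod>j<m. fst (W0 j) x) (T f) \<le> ennreal X"
      by (simp add: less_eq_ennreal.rep_eq)
    then show ?thesis
      using X(1) G(1-3) exps(1) by (intro exI[of _ G]) (simp add: Lpw_def Lpn_eq_nrm W0_def)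
  qed
  define P where "P = {j. j < m \<and> 0 < g j}"
  define Q where "Q = {j. j < m \<and> g j < 0}"
  have fin: "finite P" "finite Q" by (auto simp: P_def Q_def)
  define H where "H = (\<lambda>x. T f x * (\<Prod>j<m. w1 j x))"
  have Hm [measurable]: "H \<in> borel_measurable M"
    unfolding H_def by (intro borel_measurable_times Tm borel_measurable_prod) auto
  define b where "b = (\<Sum>j\<in>Q. - g j)"
  \<comment> \<open>Hoelder for the positive shifts starts at 1/q0 and ends at the index from which
    duality descends to 1/q1.\<close>
  have sum_g: "rinv q0 + (\<Sum>j\<in>P. g j) = rinv q1 + b"
  proof -
    have "(\<Sum>j<m. g j) = (\<Sum>j<m. if 0 < g j then g j else 0) + (\<Sum>j<m. if g j < 0 then g j else 0)"
      unfolding sum.distrib[symmetric] by (intro sum.cong) auto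
    also have "(\<Sum>j<m. if 0 < g j then g j else 0) = (\<Sum>j\<in>P. g j)"
      by (simp add: sum.If_cases P_def lessThan_def Int_def)
    also have "(\<Sum>j<m. if g j < 0 then g j else 0) = (\<Sum>j\<in>Q. g j)"
      by (simp add: sum.If_cases Q_def lessThan_def Int_def)
    finally show ?thesis using gamq by (simp add: b_def sum_negf)
  qed
  define Y where "Y = X * (\<Prod>j\<in>P. (\<kappa> powr enn2real (t1 j)) powr g j)"
  \<comment> \<open>The sign of \<open>X\<close> comes out of the hypothesis on T, for which any
    admissible F will do.\<close>
  have X0: "0 \<le> X" using main[of "\<lambda>_. 0"] by auto
  have Y0: "0 \<le> Y" unfolding Y_def using X0 by (intro mult_nonneg_nonneg prod_nonneg) auto
  \<comment> \<open>The factors \<open>G j powr g j\<close> with \<open>g j > 0\<close> cancel the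
    perturbation of w1 by Hoelder. The remaining factors have positive exponents
    \<open>- g j\<close>, so replacing \<open>G j\<close> by the smaller F only decreases the
    function, and the dependence on \<open>G\<close> is gone.\<close>
  have dual: "nrm M (rinv q1 + b) (\<lambda>x. H x * (\<Prod>j\<in>Q. F x powr (- g j))) \<le> ennreal Y"
    if F: "F \<in> borel_measurable M" "\<And>x. 0 \<le> F x" "(\<integral>\<^sup>+ x. ennreal (F x) \<partial>M) \<le> 1" for F
  proof -
    obtain G where G: "\<And>j. j < m \<Longrightarrow> weight M (G j)" "\<And>j. j < m \<Longrightarrow> g j < 0 \<Longrightarrow> AE x in M. F x \<le> G j x"
      "\<And>j. j < m \<Longrightarrow> g j \<noteq> 0 \<Longrightarrow> (\<integral>\<^sup>+ x. ennreal (G j x) \<partial>M) \<le> ennreal (\<kappa> powr enn2real (t1 j))"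
      "nrm M (rinv q0) (\<lambda>x. T f x * (\<Prod>j<m. w1 j x * G j x powr (- g j))) \<le> ennreal X"
      using main[OF F] by blast
    have Gm: "G j \<in> borel_measurable M" if "j < m" for j using G(1)[OF that] by (simp add: weight_def)
    have "nrm M (rinv q0 + (\<Sum>j\<in>P. g j))
        (\<lambda>x. T f x * (\<Prod>j<m. w1 j x * G j x powr (- g j)) * (\<Prod>j\<in>P. G j x powr g j)) \<le> ennreal Y"
      unfolding Y_def
    proof (rule Holder_nrm_prod)
      show "(\<lambda>x. T f x * (\<Prod>j<m. w1 j x * G j x powr (- g j))) \<in> borel_measurable M"
        using Gm by (intro borel_measurable_times Tm borel_measurable_prod powr_real_measurable) auto
    qed (use fin G X0 \<kappa> in \<open>auto simp: P_def\<close>)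
    moreover have "nrm M (rinv q1 + b) (\<lambda>x. H x * (\<Prod>j\<in>Q. F x powr (- g j)))
        \<le> nrm M (rinv q1 + b) (\<lambda>x. T f x * (\<Prod>j<m. w1 j x * G j x powr (- g j)) * (\<Prod>j\<in>P. G j x powr g j))"
    proof (rule nrm_mono_AE)
      show "0 \<le> rinv q1 + b"
        unfolding b_def by (intro add_nonneg_nonneg sum_nonneg) (auto simp: Q_def)
      have "AE x in M. \<forall>j\<in>Q. F x \<le> G j x"
        using fin G(2) by (intro AE_finite_allI) (auto simp: Q_def)
      then show "AE x in M. \<bar>H x * (\<Prod>j\<in>Q. F x powr (- g j))\<bar>
          \<le> \<bar>T f x * (\<Prod>j<m. w1 j x * G j x powr (- g j)) * (\<Prod>j\<in>P. G j x powr g j)\<bar>"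
        using AE_space
      proof eventually_elim
        case (elim x)
        have G0: "0 < G j x" if "j < m" for j using G(1)[OF that] elim by (simp add: weight_def)
        \<comment> \<open>Indices with \<open>g j = 0\<close> contribute the factor 1, because
          \<open>G j x\<close> is positive.\<close>
        have "(\<Prod>j<m. G j x powr (- g j))
            = (\<Prod>j<m. if 0 < g j then G j x powr (- g j) else 1) * (\<Prod>j<m. if g j < 0 then G j x powr (- g j) else 1)"
          unfolding prod.distrib[symmetric] using G0 by (intro prod.cong) (auto simp: not_less less_imp_neq[symmetric])
        also have "(\<Prod>j<m. if 0 < g j then G j x powr (- g j) else 1) = (\<Prod>j\<in>P. G j x powr (- g j))"
          by (simp add: prod.If_cases P_def lessThan_def Int_def)
        also have "(\<Prod>j<m. if g j < 0 then G j x powr (- g j) else 1) = (\<Prod>j\<in>Q. G j x powr (- g j))"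
          by (simp add: prod.If_cases Q_def lessThan_def Int_def)
        finally have "(\<Prod>j<m. G j x powr (- g j)) * (\<Prod>j\<in>P. G j x powr g j)
            = (\<Prod>j\<in>Q. G j x powr (- g j)) * (\<Prod>j\<in>P. G j x powr (- g j) * G j x powr g j)"
          by (simp add: prod.distrib mult_ac)
        also have "(\<Prod>j\<in>P. G j x powr (- g j) * G j x powr g j) = 1"
          using G0 by (intro prod.neutral) (auto simp: P_def powr_minus_divide less_imp_neq[symmetric])
        finally have eq: "T f x * (\<Prod>j<m. w1 j x * G j x powr (- g j)) * (\<Prod>j\<in>P. G j x powr g j)
            = H x * (\<Prod>j\<in>Q. G j x powr (- g j))"
          by (simp add: H_def prod.distrib mult_ac)
        have "(\<Prod>j\<in>Q. F x powr (- g j)) \<le> (\<Prod>j\<in>Q. G j x powr (- g j))"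
          using elim F(2) by (intro prod_mono) (auto simp: Q_def intro!: powr_mono2)
        then show ?case
          unfolding eq by (simp add: abs_mult abs_of_nonneg prod_nonneg mult_left_mono)
      qed
    qed
    ultimately show ?thesis by (simp add: sum_g)
  qed
  have "nrm M (rinv q1) H \<le> ennreal Y"
  \<comment> \<open>Without negative shifts \<open>b = 0\<close>, and \<open>dual\<close> is already
    the claim; the duality lemma is for \<open>b > 0\<close>.\<close>
  proof (cases "Q = {}")
    case True
    then show ?thesis using dual[of "\<lambda>_. 0"] by (simp add: b_def)
  next
    case False
    have b0: "0 < b" unfolding b_def using fin False by (intro sum_pos) (auto simp: Q_def)
    show ?thesis
    proof (rule nrm_duality[OF sf rinv_nonneg b0 Y0 Hm])
      fix F :: "'a \<Rightarrow> real"
      assume F: "F \<in> borel_measurable M" "\<And>x. 0 \<le> F x" "(\<integral>\<^sup>+ x. ennreal (F x) \<partial>M) \<le> 1"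
      have "F x powr b = (\<Prod>j\<in>Q. F x powr (- g j))" for x
      \<comment> \<open>The power law for sums of exponents is used at a nonzero base; at 0 both
        sides vanish because Q is nonempty.\<close>
      proof (cases "F x = 0")
        case True
        then show ?thesis using False fin by (simp add: card_gt_0_iff)
      next
        case False
        then show ?thesis unfolding b_def by (rule powr_sum)
      qed
      then show "nrm M (rinv q1 + b) (\<lambda>x. H x * F x powr b) \<le> ennreal Y"
        using dual[OF F] by simp
    qed
  qed
  then have "Lpw M q1 (\<lambda>x. \<Prod>j<m. w1 j x) (T f) \<le> ennreal Y"
    using exps(2) by (simp add: Lpw_def Lpn_eq_nrm H_def)
  then have "enn2ereal (Lpw M q1 (\<lambda>x. \<Prod>j<m. w1 j x) (T f)) \<le> ereal Y"
    using Y0 by (simp add: less_eq_ennreal.rep_eq)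
  also have "Y = \<kappa> powr (\<Sum>j<m. enn2real (t1 j) * \<bar>g j\<bar>) * \<phi> (C \<kappa>) * (\<Prod>j<m. A j)"
  proof -
    \<comment> \<open>\<open>K\<close> carries the cost for negative shifts and this product the
      cost for positive ones, so each component is charged once and the exponents add up to
      \<beta>.\<close>
    have "(\<Prod>j\<in>P. (\<kappa> powr enn2real (t1 j)) powr g j) = (\<Prod>j<m. if 0 < g j then \<kappa> powr (enn2real (t1 j) * g j) else 1)"
      by (simp add: prod.If_cases P_def lessThan_def Int_def powr_powr)
    then have "(\<Prod>j<m. K \<kappa> j) * (\<Prod>j\<in>P. (\<kappa> powr enn2real (t1 j)) powr g j)
        = (\<Prod>j<m. K \<kappa> j * (if 0 < g j then \<kappa> powr (enn2real (t1 j) * g j) else 1))"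
      by (simp only: prod.distrib)
    also have "\<dots> = (\<Prod>j<m. \<kappa> powr (enn2real (t1 j) * \<bar>g j\<bar>))"
      using \<kappa> by (intro prod.cong) (auto simp: K_def)
    also have "\<dots> = \<kappa> powr (\<Sum>j<m. enn2real (t1 j) * \<bar>g j\<bar>)"
      using \<kappa> by (subst powr_sum) auto
    finally show ?thesis
      unfolding Y_def X_def prod.distrib by (simp add: mult_ac)
  qed
  finally show "enn2ereal (Lpw M q1 (\<lambda>x. \<Prod>j<m. w1 j x) (T f))
            \<le> ereal (\<kappa> powr (\<Sum>j<m. enn2real (t1 j) * \<bar>g j\<bar>)
                 * \<phi> (\<lambda>j. (if g j = 0 then 1
                        else (\<kappa> / (\<kappa> - 1) * enn2real (maxop_norm M \<U> (t1 j) (vt j) (wt j)))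
                               powr (enn2real (t1 j) * \<bar>g j\<bar>))
                      * enn2real (charw M \<U> (s1 j) (r1 j) (w1 j) (v1 j))
                          powr (enn2real (t1 j) * rinv (t0 j)))
                 * (\<Prod>j<m. enn2real (Lpw M (p1 j) (v1 j) (S j (f j)))))"
    unfolding C_def A_def Nm_def .
qed

end
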